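(* Let $K\in End_{\mathcal A}^{*}(\mathcal H)$, let $\{T_w\}_{w\in\Omega}$ be a continuous $K$-operator frame for $End_{\mathcal A}^{*}(\mathcal H)$ with bounds $A$ and $B$, and let $\{R_w\}_{w\in\Omega}\subset End_{\mathcal A}^{*}(\mathcal H)$. If there exists $M>0$ such that for every $x\in\mathcal H$ $$\Big\|\int_\Omega\langle(T_w-R_w)x,(T_w-R_w)x\rangle_{\mathcal A}\,d\mu(w)\Big\|\le M\min\Big(\Big\|\int_\Omega\langle T_wx,T_wx\rangle_{\mathcal A}\,d\mu(w)\Big\|,\ \Big\|\int_\Omega\langle R_wx,R_wx\rangle_{\mathcal A}\,d\mu(w)\Big\|\Big),$$ then $\{R_w\}_{w\in\Omega}$ is a continuous $K$-operator frame for $End_{\mathcal A}^{*}(\mathcal H)$. Conversely, if $K$ is surjective and satisfies $\|x\|\le\|K^*x\|$ for all $x\in\mathcal H$ (in particular if $K$ is a co-isometry), and $\{R_w\}_{w\in\Omega}$ is a continuous $K$-operator frame for $End_{\mathcal A}^{*}(\mathcal H)$, then there exists $M>0$ such that the displayed inequality holds for every $x\in\mathcal H$.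
   Context: $\mathcal A$ is a unital $C^*$-algebra, $\mathcal H$ is a (left) Hilbert $\mathcal A$-module with $\mathcal A$-valued inner product $\langle\cdot,\cdot\rangle_{\mathcal A}$ ($\mathcal A$-linear in the first variable) and norm $\|x\|=\|\langle x,x\rangle_{\mathcal A}\|^{1/2}$, and $End_{\mathcal A}^{*}(\mathcal H)$ is the set of adjointable operators $\mathcal H\to\mathcal H$. $(\Omega,\mu)$ is a measure space; integrals of Banach-space-valued functions are Bochner integrals. Inequalities between elements of $\mathcal A$ refer to the order given by the positive cone $\mathcal A^+$. $K$ is a co-isometry if $KK^*=I$. For $K\in End_{\mathcal A}^{*}(\mathcal H)$, a family $\{T_w\}_{w\in\Omega}\subset End_{\mathcal A}^{*}(\mathcal H)$ is a continuous $K$-operator frame for $End_{\mathcal A}^{*}(\mathcal H)$ with (lower and upper) bounds $A,B>0$ if for every $x\in\mathcal H$, $A\langle K^*x,K^*x\rangle_{\mathcal A}\le\int_\Omega\langle T_wx,T_wx\rangle_{\mathcal A}\,d\mu(w)\le B\langle x,x\rangle_{\mathcal A}$. It is called a continuous $K$-operator frame if such $A,B>0$ exist. Convention: for all families of operators considered, $w\mapsto T_wx$ and $w\mapsto R_wx$ are measurable for each $x\in\mathcal H$, and an inequality involving integrals includes the assertion that these integrals exist. *)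

theory Defs
  imports "HOL-Analysis.Analysis"
begin

section \<open>Unital C*-algebras\<close>

text \<open>
  As for \<^class>\<open>real_normed_algebra_1\<close>, unital includes \<open>1 \<noteq> 0\<close>; submultiplicativity of the norm
  comes from \<^class>\<open>real_normed_algebra\<close>.
\<close>

class unital_cstar_algebra = real_normed_algebra_1 + banach +
  fixes scaleC :: "complex \<Rightarrow> 'a \<Rightarrow> 'a"
    and star :: "'a \<Rightarrow> 'a"
  assumes scaleC_add_right: "scaleC c (a + b) = scaleC c a + scaleC c b"
    and scaleC_add_left: "scaleC (c + d) a = scaleC c a + scaleC d a"
    and scaleC_scaleC: "scaleC c (scaleC d a) = scaleC (c * d) a"
    and scaleR_scaleC: "scaleR r a = scaleC (complex_of_real r) a"
    and mult_scaleC_left: "scaleC c a * b = scaleC c (a * b)"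
    and mult_scaleC_right: "a * scaleC c b = scaleC c (a * b)"
    and norm_scaleC: "norm (scaleC c a) = cmod c * norm a"
    and star_add: "star (a + b) = star a + star b"
    and star_scaleC: "star (scaleC c a) = scaleC (cnj c) (star a)"
    and star_mult: "star (a * b) = star b * star a"
    and star_star: "star (star a) = a"
    and cstar_identity: "norm (star a * a) = (norm a)\<^sup>2"

definition cstar_spectrum :: "'a::unital_cstar_algebra \<Rightarrow> complex set" where
  "cstar_spectrum a = {z. \<not> (\<exists>b. b * (scaleC z 1 - a) = 1 \<and> (scaleC z 1 - a) * b = 1)}"

definition cstar_positive :: "'a::unital_cstar_algebra \<Rightarrow> bool" where
  "cstar_positive a \<longleftrightarrow> star a = a \<and> (\<forall>z\<in>cstar_spectrum a. z \<in> \<real> \<and> 0 \<le> Re z)"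

definition cstar_le :: "'a::unital_cstar_algebra \<Rightarrow> 'a \<Rightarrow> bool"  (infix \<open>\<sqsubseteq>\<close> 50) where
  "a \<sqsubseteq> b \<longleftrightarrow> cstar_positive (b - a)"

section \<open>Hilbert C*-modules and adjointable operators\<close>

text \<open>
  The complex vector space structure of the module is \<open>(c, x) \<mapsto> smult (scaleC c 1) x\<close>;
  \<open>smult_scaleR\<close> says that it extends the real one of the type. Completeness is part of
  \<^class>\<open>banach\<close>.
\<close>

locale hilbert_cstar_module =
  fixes smult :: "'a::unital_cstar_algebra \<Rightarrow> 'h::banach \<Rightarrow> 'h"
    and ip :: "'h \<Rightarrow> 'h \<Rightarrow> 'a"
  assumes smult_add_right: "smult a (x + y) = smult a x + smult a y"
    and smult_add_left: "smult (a + b) x = smult a x + smult b x"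
    and smult_smult: "smult a (smult b x) = smult (a * b) x"
    and smult_one: "smult 1 x = x"
    and smult_scaleR: "smult (r *\<^sub>R 1) x = r *\<^sub>R x"
    and ip_add_left: "ip (x + y) z = ip x z + ip y z"
    and ip_smult_left: "ip (smult a x) y = a * ip x y"
    and ip_star: "ip x y = star (ip y x)"
    and ip_positive: "cstar_positive (ip x x)"
    and ip_definite: "ip x x = 0 \<Longrightarrow> x = 0"
    and norm_ip: "norm x = sqrt (norm (ip x x))"

definition is_adjoint :: "('h \<Rightarrow> 'h \<Rightarrow> 'a) \<Rightarrow> ('h \<Rightarrow> 'h) \<Rightarrow> ('h \<Rightarrow> 'h) \<Rightarrow> bool" where
  "is_adjoint ip T S \<longleftrightarrow> (\<forall>x y. ip (T x) y = ip x (S y))"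

definition adjointable :: "('h \<Rightarrow> 'h \<Rightarrow> 'a) \<Rightarrow> ('h \<Rightarrow> 'h) \<Rightarrow> bool" where
  "adjointable ip T \<longleftrightarrow> (\<exists>S. is_adjoint ip T S)"

definition adj :: "('h \<Rightarrow> 'h \<Rightarrow> 'a) \<Rightarrow> ('h \<Rightarrow> 'h) \<Rightarrow> 'h \<Rightarrow> 'h" where
  "adj ip T = (THE S. is_adjoint ip T S)"

section \<open>The Bochner integral without separability\<close>

text \<open>
  The library's \<^const>\<open>has_bochner_integral\<close> is restricted to second countable value types, whereas
  a C*-algebra need not be separable. The definitions below are the library's with Borel
  measurability replaced by strong measurability; on second countable types the notions
  coincide.
\<close>

definition strongly_measurable :: "'w measure \<Rightarrow> ('w \<Rightarrow> 'b::real_normed_vector) \<Rightarrow> bool" where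
  "strongly_measurable M f \<longleftrightarrow>
     (\<exists>s. (\<forall>i. simple_function M (s i)) \<and> (\<forall>w\<in>space M. (\<lambda>i::nat. s i w) \<longlonglongrightarrow> f w))"

definition has_strong_integral :: "'w measure \<Rightarrow> ('w \<Rightarrow> 'b::real_normed_vector) \<Rightarrow> 'b \<Rightarrow> bool" where
  "has_strong_integral M f I \<longleftrightarrow> strongly_measurable M f \<and>
     (\<exists>s. (\<forall>i::nat. Bochner_Integration.simple_bochner_integrable M (s i)) \<and>
          (\<lambda>i. \<integral>\<^sup>+w. ennreal (norm (f w - s i w)) \<partial>M) \<longlonglongrightarrow> 0 \<and>
          (\<lambda>i. Bochner_Integration.simple_bochner_integral M (s i)) \<longlonglongrightarrow> I)"

definition strong_integrable :: "'w measure \<Rightarrow> ('w \<Rightarrow> 'b::real_normed_vector) \<Rightarrow> bool" where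
  "strong_integrable M f \<longleftrightarrow> (\<exists>I. has_strong_integral M f I)"

definition strong_integral :: "'w measure \<Rightarrow> ('w \<Rightarrow> 'b::real_normed_vector) \<Rightarrow> 'b" where
  "strong_integral M f = (THE I. has_strong_integral M f I)"

lemma strongly_measurable_iff_borel_measurable:
  fixes f :: "'w \<Rightarrow> 'b::{real_normed_vector, second_countable_topology}"
  shows "strongly_measurable M f \<longleftrightarrow> f \<in> borel_measurable M"
proof
  assume "strongly_measurable M f"
  then obtain s where "\<And>i. simple_function M (s i)"
    and lim: "\<And>w. w \<in> space M \<Longrightarrow> (\<lambda>i::nat. s i w) \<longlonglongrightarrow> f w"
    unfolding strongly_measurable_def by blast
  then have "\<And>i. s i \<in> borel_measurable M"
    by (simp add: borel_measurable_simple_function)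
  from borel_measurable_LIMSEQ_metric[OF this lim] show "f \<in> borel_measurable M" .
next
  assume "f \<in> borel_measurable M"
  then show "strongly_measurable M f"
    unfolding strongly_measurable_def
    using borel_measurable_implies_sequence_metric[of f M 0] by blast
qed

lemma has_strong_integral_iff_has_bochner_integral:
  fixes f :: "'w \<Rightarrow> 'b::{real_normed_vector, second_countable_topology}"
  shows "has_strong_integral M f I \<longleftrightarrow> has_bochner_integral M f I"
  unfolding has_strong_integral_def has_bochner_integral.simps
    strongly_measurable_iff_borel_measurable by blast

section \<open>Continuous K-operator frames\<close>

text \<open>\<open>\<Omega>\<close> is \<^term>\<open>space M\<close>; the values of a family outside it are irrelevant.\<close>

definition operator_family ::
    "('h::banach \<Rightarrow> 'h \<Rightarrow> 'a) \<Rightarrow> 'w measure \<Rightarrow> ('w \<Rightarrow> 'h \<Rightarrow> 'h) \<Rightarrow> bool" where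
  "operator_family ip M T \<longleftrightarrow>
     (\<forall>w\<in>space M. adjointable ip (T w)) \<and> (\<forall>x. strongly_measurable M (\<lambda>w. T w x))"

definition square_integrable ::
    "('h \<Rightarrow> 'h \<Rightarrow> 'a::unital_cstar_algebra) \<Rightarrow> 'w measure \<Rightarrow> ('w \<Rightarrow> 'h \<Rightarrow> 'h) \<Rightarrow> 'h \<Rightarrow> bool" where
  "square_integrable ip M T x \<longleftrightarrow> strong_integrable M (\<lambda>w. ip (T w x) (T w x))"

definition square_integral ::
    "('h \<Rightarrow> 'h \<Rightarrow> 'a::unital_cstar_algebra) \<Rightarrow> 'w measure \<Rightarrow> ('w \<Rightarrow> 'h \<Rightarrow> 'h) \<Rightarrow> 'h \<Rightarrow> 'a" where
  "square_integral ip M T x = strong_integral M (\<lambda>w. ip (T w x) (T w x))"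

definition K_operator_frame_bounds ::
    "('h::banach \<Rightarrow> 'h \<Rightarrow> 'a::unital_cstar_algebra) \<Rightarrow> 'w measure \<Rightarrow> ('h \<Rightarrow> 'h) \<Rightarrow>
     ('w \<Rightarrow> 'h \<Rightarrow> 'h) \<Rightarrow> real \<Rightarrow> real \<Rightarrow> bool" where
  "K_operator_frame_bounds ip M K T A B \<longleftrightarrow>
     operator_family ip M T \<and> 0 < A \<and> 0 < B \<and>
     (\<forall>x. square_integrable ip M T x \<and>
          A *\<^sub>R ip (adj ip K x) (adj ip K x) \<sqsubseteq> square_integral ip M T x \<and>
          square_integral ip M T x \<sqsubseteq> B *\<^sub>R ip x x)"

definition K_operator_frame ::
    "('h::banach \<Rightarrow> 'h \<Rightarrow> 'a::unital_cstar_algebra) \<Rightarrow> 'w measure \<Rightarrow> ('h \<Rightarrow> 'h) \<Rightarrow>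
     ('w \<Rightarrow> 'h \<Rightarrow> 'h) \<Rightarrow> bool" where
  "K_operator_frame ip M K T \<longleftrightarrow> (\<exists>A B. K_operator_frame_bounds ip M K T A B)"

end

theory Submission
  imports Defs "HOL-Computational_Algebra.Formal_Power_Series"
begin

text \<open>
  Write \<open>q\<^sub>S x\<close> for the integral of \<open>ip (S w x) (S w x)\<close> and \<open>D = T - R\<close>.

  The theorem is easy once the two frame inequalities are known to be equivalent to inequalities
  between norms, \<open>A \<parallel>K* x\<parallel>\<^sup>2 \<le> \<parallel>q\<^sub>S x\<parallel> \<le> B \<parallel>x\<parallel>\<^sup>2\<close> for all \<open>x\<close> (\<open>K_operator_frame_bounds_iff_norm\<close>). The
  parallelogram law gives \<open>q\<^sub>R \<le> 2 (q\<^sub>T + q\<^sub>D)\<close>, \<open>q\<^sub>T \<le> 2 (q\<^sub>D + q\<^sub>R)\<close> and \<open>q\<^sub>D \<le> 2 (q\<^sub>T + q\<^sub>R)\<close>. If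
  \<open>\<parallel>q\<^sub>D x\<parallel>\<close> is dominated by \<open>M\<close> times each of \<open>\<parallel>q\<^sub>T x\<parallel>\<close> and \<open>\<parallel>q\<^sub>R x\<parallel>\<close>, the first two make these
  norms comparable with constant \<open>2 (1 + M)\<close>, and the bounds of \<open>T\<close> carry over to \<open>R\<close>. Conversely,
  if both families are frames and \<open>\<parallel>x\<parallel> \<le> \<parallel>K* x\<parallel>\<close>, then both norms are bounded below, and \<open>\<parallel>q\<^sub>D x\<parallel>\<close>
  above, by a multiple of \<open>\<parallel>x\<parallel>\<^sup>2\<close>.

  That order inequalities give norm inequalities is monotonicity of the norm on positive elements
  (\<open>cstar_positive_norm_mono\<close>). The reverse passage (\<open>cstar_le_scaleR_if_norm_conj_le\<close>) uses that
  the norm inequality holds for all vectors \<open>h x\<close>, where \<open>h\<close> runs through the algebra: to prove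
  \<open>p \<le> C q\<close>, normalise by \<open>h = (q + e) powr (-1/2)\<close>, where a norm bound is the same as an
  order bound.

  Positivity is defined by the spectrum, so these arguments need a link between spectrum and norm
  and a supply of square roots. Both come from the binomial series of \<open>sqrt (1 - x)\<close>, which converges
  absolutely for \<open>norm x \<le> 1\<close> (\<open>sqrt_one_minus\<close>): it shows that a self-adjoint \<open>a\<close> has \<open>norm a\<close> or
  \<open>- norm a\<close> in its spectrum (\<open>norm_mem_cstar_spectrum\<close>), and from this that a self-adjoint \<open>a\<close> is
  positive iff \<open>norm (t - a) \<le> t\<close> for \<open>t = norm a\<close>. This description by the norm also shows
  that the integral of a positive function is positive (\<open>has_strong_integral_positive\<close>).
\<close>

section \<open>The involution and the complex scalars\<close>

lemma star_one: "star (1::'a::unital_cstar_algebra) = 1"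
  by (metis mult_1_right mult_1_left star_mult star_star)

lemma norm_star: "norm (star a) = norm (a::'a::unital_cstar_algebra)"
proof -
  have le: "norm b \<le> norm (star b)" for b :: 'a
  proof (cases "b = 0")
    case False
    have "norm b * norm b \<le> norm (star b) * norm b"
      using cstar_identity[of b] norm_mult_ineq[of "star b" b] by (simp add: power2_eq_square)
    then show ?thesis using False by simp
  qed auto
  show ?thesis
    using le[of a] le[of "star a"] by (simp add: star_star)
qed

lemma star_scaleR: "star (r *\<^sub>R a) = r *\<^sub>R star (a::'a::unital_cstar_algebra)"
  by (simp add: scaleR_scaleC star_scaleC)

lemma bounded_linear_star: "bounded_linear (star :: 'a::unital_cstar_algebra \<Rightarrow> 'a)"
  by (rule bounded_linear_intro[where K=1]) (auto simp: star_add star_scaleR norm_star)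

lemmas star_diff = linear_diff[OF bounded_linear.linear[OF bounded_linear_star]]
  and star_zero = linear_0[OF bounded_linear.linear[OF bounded_linear_star]]

lemma star_power: "star (a ^ n) = star (a::'a::unital_cstar_algebra) ^ n"
  by (induction n) (simp_all add: star_one star_mult power_commutes)

lemma scaleC_one: "scaleC 1 (a::'a::unital_cstar_algebra) = a"
  using scaleR_scaleC[of 1 a] by simp

lemma scaleC_minus_right: "scaleC z (- a) = - scaleC z (a::'a::unital_cstar_algebra)"
proof -
  have "scaleC z (- a) + scaleC z a = 0"
    using scaleC_add_right[of z 0 0] scaleC_add_right[of z "- a" a, symmetric] by simp
  then show ?thesis by (simp add: eq_neg_iff_add_eq_0)
qed

lemma scaleC_diff_right: "scaleC z (a - b) = scaleC z a - scaleC z (b::'a::unital_cstar_algebra)"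
  using scaleC_add_right[of z a "- b"] by (simp add: scaleC_minus_right)

lemma scaleC_diff_left: "scaleC (z - w) a = scaleC z a - scaleC w (a::'a::unital_cstar_algebra)"
  using scaleC_add_left[of "z - w" w a] by (simp add: algebra_simps)

lemma scaleC_minus_left: "scaleC (- z) a = - scaleC z (a::'a::unital_cstar_algebra)"
  using scaleC_diff_left[of 0 z a] scaleC_diff_left[of 0 0 a] by simp

section \<open>Invertible elements and the spectrum\<close>

definition has_inverse :: "'a::ring_1 \<Rightarrow> bool" where
  "has_inverse x \<longleftrightarrow> (\<exists>b. b * x = 1 \<and> x * b = 1)"

lemma mem_cstar_spectrum: "z \<in> cstar_spectrum a \<longleftrightarrow> \<not> has_inverse (scaleC z 1 - a)"
  by (simp add: cstar_spectrum_def has_inverse_def)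

lemma has_inverse_mult:
  assumes "has_inverse x" "has_inverse y" shows "has_inverse (x * y)"
proof -
  obtain a b where *: "a * x = 1" "x * a = 1" "b * y = 1" "y * b = 1"
    using assms unfolding has_inverse_def by blast
  have "(b * a) * (x * y) = b * (a * x) * y" "(x * y) * (b * a) = x * (y * b) * a"
    by (simp_all only: mult.assoc)
  then show ?thesis
    unfolding has_inverse_def using * by (metis mult_1_right)
qed

lemma has_inverse_minus_iff: "has_inverse (- x) \<longleftrightarrow> has_inverse x"
proof -
  have "has_inverse (- x)" if "has_inverse x" for x :: 'a
    using that unfolding has_inverse_def by (metis minus_mult_minus)
  from this[of x] this[of "- x"] show ?thesis by auto
qed

lemma has_inverse_scaleC:
  fixes x :: "'a::unital_cstar_algebra"
  assumes "has_inverse x" "z \<noteq> 0" shows "has_inverse (scaleC z x)"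
proof -
  obtain b where "b * x = 1" "x * b = 1" using assms(1) unfolding has_inverse_def by blast
  then have "scaleC (1/z) b * scaleC z x = 1" "scaleC z x * scaleC (1/z) b = 1"
    using assms(2) by (simp_all add: mult_scaleC_left mult_scaleC_right scaleC_scaleC scaleC_one)
  then show ?thesis unfolding has_inverse_def by blast
qed

lemma has_inverse_scaleR:
  fixes x :: "'a::unital_cstar_algebra"
  shows "has_inverse x \<Longrightarrow> r \<noteq> 0 \<Longrightarrow> has_inverse (r *\<^sub>R x)"
  by (simp add: scaleR_scaleC has_inverse_scaleC)

lemma has_inverse_one_minus:
  fixes x :: "'a::{real_normed_algebra_1,banach}"
  assumes "norm x < 1" shows "has_inverse (1 - x)"
proof -
  have sm: "summable (\<lambda>n. x ^ n)" using assms by (rule complete_algebra_summable_geometric)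
  define s where "s = (\<Sum>n. x ^ n)"
  have "(\<Sum>n. x ^ Suc n) = s - 1"
    using suminf_split_head[OF sm] by (simp add: s_def)
  moreover have "(\<Sum>n. x ^ Suc n) = x * s"
    using suminf_mult[OF sm, of x] by (simp add: s_def)
  moreover have "(\<Sum>n. x ^ Suc n) = s * x"
    using suminf_mult2[OF sm, of x] by (simp add: s_def power_commutes)
  ultimately have "s * (1 - x) = 1" "(1 - x) * s = 1"
    by (simp_all add: algebra_simps)
  then show ?thesis unfolding has_inverse_def by blast
qed

lemma cstar_spectrum_norm_le:
  fixes a :: "'a::unital_cstar_algebra"
  assumes "z \<in> cstar_spectrum a" shows "cmod z \<le> norm a"
proof (rule ccontr)
  assume "\<not> ?thesis"
  then have less: "norm a < cmod z" by simp
  then have z: "z \<noteq> 0" using norm_ge_zero[of a] by (auto simp del: norm_ge_zero)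
  have "norm (scaleC (1/z) a) < 1"
    using less z by (simp add: norm_scaleC norm_divide field_simps)
  then have "has_inverse (scaleC z (1 - scaleC (1/z) a))"
    using z by (intro has_inverse_scaleC has_inverse_one_minus)
  also have "scaleC z (1 - scaleC (1/z) a) = scaleC z 1 - a"
    using z by (simp add: scaleC_diff_right scaleC_scaleC scaleC_one)
  finally show False using assms by (simp add: mem_cstar_spectrum)
qed

lemma cstar_spectrum_diff:
  fixes a :: "'a::unital_cstar_algebra"
  shows "c - z \<in> cstar_spectrum (scaleC c 1 - a) \<longleftrightarrow> z \<in> cstar_spectrum a"
proof -
  have "scaleC (c - z) 1 - (scaleC c 1 - a) = - (scaleC z 1 - a)"
    by (simp add: scaleC_diff_left)
  then show ?thesis unfolding mem_cstar_spectrum by (simp only: has_inverse_minus_iff)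
qed

lemma cstar_spectrum_diff_real:
  fixes a :: "'a::unital_cstar_algebra"
  shows "complex_of_real (t - s) \<in> cstar_spectrum (t *\<^sub>R 1 - a) \<longleftrightarrow> complex_of_real s \<in> cstar_spectrum a"
  using cstar_spectrum_diff[of "complex_of_real t" "complex_of_real s" a] by (simp add: scaleR_scaleC)

text \<open>
  Arens' trick: shifting \<open>a\<close> by \<open>\<i> s\<close> moves the imaginary part of a spectral value by \<open>s\<close>, whereas
  by the C*-identity \<open>\<parallel>a + \<i> s\<parallel>\<^sup>2 \<le> \<parallel>a\<parallel>\<^sup>2 + s\<^sup>2\<close>. A nonzero imaginary part would
  contradict this for large \<open>s\<close> of the same sign.
\<close>

lemma selfadjoint_spectrum_real:
  fixes a :: "'a::unital_cstar_algebra"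
  assumes a: "star a = a" and z: "z \<in> cstar_spectrum a" shows "Im z = 0"
proof (rule ccontr)
  assume im: "Im z \<noteq> 0"
  \<comment> \<open>The shift for which the cross term \<open>2 * Im z * s\<close> exceeds the bound \<open>(norm a)\<^sup>2\<close>.\<close>
  define s where "s = (norm a)\<^sup>2 / Im z"
  define c where "c = scaleC (\<i> * s) 1 + a"
  have "z + \<i> * s \<in> cstar_spectrum c"
    using z by (simp add: mem_cstar_spectrum c_def scaleC_add_left)
  then have 1: "cmod (z + \<i> * s) \<le> norm c" by (rule cstar_spectrum_norm_le)
  have sc: "star c = a - scaleC (\<i> * s) 1"
    by (simp add: c_def star_add star_scaleC star_one a scaleC_minus_left)
  have "star c * c = a * a + (s\<^sup>2) *\<^sub>R 1"
    unfolding sc by (simp add: c_def algebra_simps mult_scaleC_left mult_scaleC_right scaleC_scaleC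
        power2_eq_square scaleC_diff_right scaleC_minus_left scaleR_scaleC)
  then have "(norm c)\<^sup>2 = norm (a * a + (s\<^sup>2) *\<^sub>R 1)"
    using cstar_identity[of c] by simp
  also have "\<dots> \<le> norm (a * a) + norm ((s\<^sup>2) *\<^sub>R (1::'a))" by (rule norm_triangle_ineq)
  also have "\<dots> = (norm a)\<^sup>2 + s\<^sup>2" using cstar_identity[of a] a by simp
  finally have 2: "(norm c)\<^sup>2 \<le> (norm a)\<^sup>2 + s\<^sup>2" .
  have "(cmod (z + \<i> * s))\<^sup>2 \<le> (norm c)\<^sup>2" using 1 by (intro power_mono) auto
  then have "(Re z)\<^sup>2 + (Im z + s)\<^sup>2 \<le> (norm a)\<^sup>2 + s\<^sup>2"
    using 2 by (simp add: cmod_power2)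
  then have "(Im z)\<^sup>2 + 2 * (Im z * s) \<le> (norm a)\<^sup>2"
    unfolding power2_sum using zero_le_power2[of "Re z"] by linarith
  moreover have "Im z * s = (norm a)\<^sup>2" using im by (simp add: s_def)
  ultimately have "(Im z)\<^sup>2 + (norm a)\<^sup>2 \<le> 0" by simp
  moreover have "0 < (Im z)\<^sup>2" using im by simp
  ultimately show False using zero_le_power2[of "norm a"] by linarith
qed

section \<open>Square roots by the binomial series\<close>

text \<open>
  The Taylor coefficients of \<open>sqrt (1 - x)\<close> at \<open>0\<close>. All but the first are nonpositive and all
  partial sums are nonnegative, so the series converges absolutely on the closed unit ball, and
  not merely inside it. The boundary is where it is needed: for a positive \<open>a\<close> the element
  \<open>1 - a / norm a\<close> has norm at most \<open>1\<close>, with equality in many cases.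
\<close>

definition sqrt_coeff :: "nat \<Rightarrow> real" where
  "sqrt_coeff n = (1/2 gchoose n) * (- 1) ^ n"

lemma sqrt_coeff_0: "sqrt_coeff 0 = 1"
  by (simp add: sqrt_coeff_def)

lemma gbinomial_Suc_ratio: "((a::real) gchoose Suc n) = (a gchoose n) * (a - n) / Suc n"
  using gbinomial_mult_1[of a n] by (simp add: field_simps)

lemma sqrt_coeff_nonpos: "sqrt_coeff (Suc n) \<le> 0"
proof (induction n)
  case 0 show ?case by (simp add: sqrt_coeff_def)
next
  case (Suc n)
  have "sqrt_coeff (Suc (Suc n)) = sqrt_coeff (Suc n) * ((Suc n - 1/2) / Suc (Suc n))"
    unfolding sqrt_coeff_def gbinomial_Suc_ratio[of _ "Suc n"] by (simp add: field_simps)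
  moreover have "sqrt_coeff (Suc n) * ((Suc n - 1/2) / Suc (Suc n)) \<le> 0"
    using Suc by (intro mult_nonpos_nonneg) auto
  ultimately show ?case by simp
qed

lemma sum_sqrt_coeff_nonneg: "0 \<le> (\<Sum>k\<le>n. sqrt_coeff k)"
proof -
  have "0 \<le> (- 1) ^ n * (- 1/2 gchoose n :: real)"
  proof (induction n)
    case (Suc n)
    have "(- 1) ^ Suc n * (- 1/2 gchoose Suc n :: real)
        = ((- 1) ^ n * (- 1/2 gchoose n)) * ((n + 1/2) / Suc n)"
      unfolding gbinomial_Suc_ratio by (simp add: field_simps)
    moreover have "0 \<le> ((- 1) ^ n * (- 1/2 gchoose n)) * ((n + 1/2) / Suc n :: real)"
      by (rule mult_nonneg_nonneg[OF Suc]) auto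
    ultimately show ?case by simp
  qed auto
  then show ?thesis
    using gbinomial_sum_lower_neg[of "1/2::real" n] by (simp add: sqrt_coeff_def)
qed

lemma summable_abs_sqrt_coeff: "summable (\<lambda>n. \<bar>sqrt_coeff n\<bar>)"
proof (rule bounded_imp_summable)
  fix n
  have "(\<Sum>k\<le>n. \<bar>sqrt_coeff k\<bar>) = 2 - (\<Sum>k\<le>n. sqrt_coeff k)"
  proof (induction n)
    case (Suc n) then show ?case using sqrt_coeff_nonpos[of n] by simp
  qed (simp add: sqrt_coeff_0)
  then show "(\<Sum>k\<le>n. \<bar>sqrt_coeff k\<bar>) \<le> 2" using sum_sqrt_coeff_nonneg[of n] by simp
qed auto

text \<open>
  Vandermonde's identity for \<open>(1 - x) powr (1/2) * (1 - x) powr (1/2) = 1 - x\<close>.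
\<close>

lemma sqrt_coeff_convolution:
  "(\<Sum>i\<le>n. sqrt_coeff i * sqrt_coeff (n - i)) = (if n = 0 then 1 else if n = 1 then - 1 else 0)"
proof -
  have "(\<Sum>i\<le>n. sqrt_coeff i * sqrt_coeff (n - i))
      = (\<Sum>i\<le>n. (- 1) ^ n * ((1/2 gchoose i) * (1/2 gchoose (n - i))))"
  proof (rule sum.cong)
    fix i assume "i \<in> {..n}"
    then have "(- 1::real) ^ n = (- 1) ^ i * (- 1) ^ (n - i)"
      by (simp flip: power_add)
    then show "sqrt_coeff i * sqrt_coeff (n - i)
      = (- 1) ^ n * ((1/2 gchoose i) * (1/2 gchoose (n - i)))"
      by (simp add: sqrt_coeff_def)
  qed simp
  also have "\<dots> = (- 1) ^ n * (1 gchoose n)"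
    using gbinomial_Vandermonde[of "1/2::real" "1/2" n]
    by (simp flip: sum_distrib_left atMost_atLeast0)
  also have "(1::real) gchoose n = of_nat (1 choose n)"
    using binomial_gbinomial[of 1 n, where 'a=real] by simp
  also have "(- 1) ^ n * real (1 choose n) = (if n = 0 then 1 else if n = 1 then - 1 else 0)"
    by (cases n; cases "n - 1") auto
  finally show ?thesis .
qed

text \<open>
  The root is a norm limit of polynomials in \<open>x\<close> with real coefficients, so it inherits from \<open>x\<close>
  self-adjointness and the elements that it commutes with. This replaces the functional calculus
  in everything that follows.
\<close>

lemma sqrt_one_minus:
  fixes x :: "'a::unital_cstar_algebra"
  assumes "norm x \<le> 1"
  obtains r where "r * r = 1 - x" "\<And>y. y * x = x * y \<Longrightarrow> y * r = r * y" "star x = x \<Longrightarrow> star r = r"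
proof -
  let ?f = "\<lambda>n. sqrt_coeff n *\<^sub>R x ^ n"
  have norm_sm: "summable (\<lambda>n. norm (?f n))"
  proof (rule summable_comparison_test'[OF summable_abs_sqrt_coeff])
    fix n :: nat
    have "norm (x ^ n) \<le> 1"
      using norm_power_ineq[of x n] power_le_one[of "norm x" n] assms by simp
    then show "norm (norm (?f n)) \<le> \<bar>sqrt_coeff n\<bar>"
      by (simp add: mult_left_le)
  qed
  then have sm: "summable ?f" by (rule summable_norm_cancel)
  define r where "r = (\<Sum>n. ?f n)"
  have "(\<lambda>k. \<Sum>i\<le>k. ?f i * ?f (k - i)) sums (r * r)"
    unfolding r_def by (rule Cauchy_product_sums[OF norm_sm norm_sm])
  moreover have "(\<Sum>i\<le>k. ?f i * ?f (k - i)) = (if k = 0 then 1 else if k = 1 then - 1 else 0) *\<^sub>R x ^ k" for k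
    unfolding sqrt_coeff_convolution[symmetric] scaleR_sum_left
    by (intro sum.cong) (auto simp flip: power_add)
  ultimately have "(\<lambda>k. (if k = 0 then 1 else if k = 1 then - 1 else 0) *\<^sub>R x ^ k) sums (r * r)"
    by simp
  moreover have "(\<lambda>k. (if k = 0 then 1 else if k = 1 then - 1 else 0) *\<^sub>R x ^ k) sums
      (\<Sum>k\<in>{0,1}. (if k = 0 then 1 else if k = 1 then - 1 else 0) *\<^sub>R x ^ k)"
    by (rule sums_finite) auto
  ultimately have "r * r = (\<Sum>k\<in>{0,1::nat}. (if k = 0 then 1 else if k = 1 then - 1 else 0) *\<^sub>R x ^ k)"
    by (rule sums_unique2)
  then have "r * r = 1 - x" by simp
  moreover have "y * r = r * y" if "y * x = x * y" for y
  proof -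
    have "x ^ n * y = y * x ^ n" for n
      using power_commuting_commutes[OF that[symmetric]] .
    then show ?thesis
      unfolding r_def using suminf_mult[OF sm, of y] suminf_mult2[OF sm, of y] by simp
  qed
  moreover have "star r = r" if "star x = x"
    unfolding r_def using bounded_linear.suminf[OF bounded_linear_star sm]
    by (simp add: star_scaleR star_power that)
  ultimately show ?thesis using that by blast
qed

section \<open>The norm of a self-adjoint element is attained on the spectrum\<close>

lemma norm_square_selfadjoint:
  fixes x :: "'a::unital_cstar_algebra"
  shows "star x = x \<Longrightarrow> norm (x * x) = (norm x)\<^sup>2"
  using cstar_identity[of x] by simp

text \<open>
  For commuting self-adjoint \<open>x\<close> and \<open>y\<close> the sum of squares is \<open>star c * c\<close> with \<open>c = x + \<i> y\<close>,
  and \<open>x\<close> is the real part of \<open>c\<close>. This is a first case of monotonicity of the norm on positive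
  elements, from which the theory of positivity is developed.
\<close>

lemma norm_square_le_norm_sum_squares:
  fixes x y :: "'a::unital_cstar_algebra"
  assumes sa: "star x = x" "star y = y" and comm: "x * y = y * x"
  shows "norm (x * x) \<le> norm (x * x + y * y)"
proof -
  define c where "c = x + scaleC \<i> y"
  have sc: "star c = x - scaleC \<i> y"
    by (simp add: c_def star_add star_scaleC sa scaleC_minus_left)
  have "star c * c = x * x + y * y"
    unfolding sc unfolding c_def
    by (simp add: algebra_simps mult_scaleC_left mult_scaleC_right scaleC_scaleC comm
        scaleC_add_right scaleC_diff_right scaleC_minus_left scaleC_one)
  then have nc: "(norm c)\<^sup>2 = norm (x * x + y * y)" using cstar_identity[of c] by simp
  have "2 *\<^sub>R x = c + star c" unfolding sc by (simp add: c_def scaleR_2)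
  then have "2 * norm x = norm (c + star c)" by (metis abs_numeral norm_scaleR)
  also have "\<dots> \<le> norm c + norm (star c)" by (rule norm_triangle_ineq)
  finally have "norm x \<le> norm c" by (simp add: norm_star)
  then have "(norm x)\<^sup>2 \<le> (norm c)\<^sup>2" by (intro power_mono) auto
  then show ?thesis using nc norm_square_selfadjoint[OF sa(1)] by simp
qed

lemma inverse_commutes:
  fixes x y g :: "'a::ring_1"
  assumes "g * x = 1" "x * g = 1" "y * x = x * y" shows "y * g = g * y"
  by (metis assms mult.assoc mult_1_left mult_1_right)

lemma inverse_selfadjoint:
  fixes x g :: "'a::unital_cstar_algebra"
  assumes "g * x = 1" "x * g = 1" "star x = x" shows "star g = g"
  by (metis assms mult.assoc mult_1_left mult_1_right star_mult star_one)

text \<open>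
  This takes the place of the spectral radius formula. If \<open>g\<close> were the inverse of \<open>1 - e\<^sup>2\<close> and
  \<open>C = norm g\<close>, then \<open>g \<le> C\<close> would give \<open>1 - e\<^sup>2 \<ge> 1/C\<close> and hence \<open>norm (e\<^sup>2) \<le> 1 - 1/C < 1\<close>.
  The order argument is carried out with explicit commuting roots \<open>r\<^sup>2 = 1 - e\<^sup>2\<close> and
  \<open>t\<^sup>2 = 1 - g/C\<close>, for which \<open>e\<^sup>2 + (t r)\<^sup>2 = 1 - 1/C\<close>.
\<close>

lemma not_has_inverse_one_minus_square:
  fixes e :: "'a::unital_cstar_algebra"
  assumes sa: "star e = e" and n1: "norm e = 1"
  shows "\<not> has_inverse (1 - e * e)"
proof
  assume "has_inverse (1 - e * e)"
  then obtain g where g: "g * (1 - e * e) = 1" "(1 - e * e) * g = 1"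
    unfolding has_inverse_def by blast
  have nf: "norm (e * e) = 1" using norm_square_selfadjoint[OF sa] n1 by simp
  have saf: "star (e * e) = e * e" by (simp add: star_mult sa)
  have sag: "star g = g"
    by (rule inverse_selfadjoint[OF g]) (simp add: star_diff star_one saf)
  obtain r where r: "r * r = 1 - e * e" "\<And>y. y * (e * e) = e * e * y \<Longrightarrow> y * r = r * y" "star r = r"
    using sqrt_one_minus[of "e * e"] nf saf by (metis order_refl)
  define C where "C = norm g"
  have er: "e * r = r * e" by (rule r(2)) (simp add: mult.assoc)
  \<comment> \<open>\<open>C \<ge> 1\<close>, because \<open>1 - e\<^sup>2\<close> is one of two squares that add up to \<open>1\<close>.\<close>
  have "norm (r * r) \<le> norm (r * r + e * e)"
    using r(3) sa er by (intro norm_square_le_norm_sum_squares) auto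
  then have "norm (1 - e * e) \<le> 1" by (simp add: r(1))
  moreover have "1 \<le> norm (1 - e * e) * norm g"
    using norm_mult_ineq[of "1 - e * e" g] g by simp
  ultimately have C: "1 \<le> C"
    using mult_right_mono[of "norm (1 - e * e)" 1 "norm g"] by (simp add: C_def)
  have "norm ((1/C) *\<^sub>R g) \<le> 1" using C by (simp add: C_def)
  then obtain t where t: "t * t = 1 - (1/C) *\<^sub>R g"
      "\<And>y. y * ((1/C) *\<^sub>R g) = (1/C) *\<^sub>R g * y \<Longrightarrow> y * t = t * y" "star t = t"
    using sqrt_one_minus[of "(1/C) *\<^sub>R g"] by (metis sag star_scaleR)
  have eg: "e * g = g * e"
    by (rule inverse_commutes[OF g]) (simp add: algebra_simps)
  have rg: "r * g = g * r"
    using r(2)[of g] eg by (metis mult.assoc)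
  have et: "e * t = t * e" by (rule t(2)) (simp add: eg)
  have rt: "r * t = t * r" by (rule t(2)) (simp add: rg)
  have "(t * r) * (t * r) = (t * t) * (r * r)" using rt by (metis mult.assoc)
  also have "\<dots> = (1 - e * e) - (1/C) *\<^sub>R 1"
    unfolding t(1) r(1) using g(1) by (simp add: left_diff_distrib)
  finally have sq: "(e * e) + (t * r) * (t * r) = (1 - 1/C) *\<^sub>R 1"
    by (simp add: scaleR_left_diff_distrib)
  have "norm (e * e) \<le> norm ((e * e) + (t * r) * (t * r))"
  proof (intro norm_square_le_norm_sum_squares sa)
    show "star (t * r) = t * r" by (simp add: star_mult t(3) r(3) rt)
    show "e * (t * r) = t * r * e" using et er by (metis mult.assoc)
  qed
  then have "1 \<le> \<bar>1 - 1/C\<bar>" unfolding sq nf by simp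
  then show False using C by (simp add: abs_if field_simps split: if_splits)
qed

text \<open>
  After scaling \<open>a\<close> to norm \<open>1\<close>: if \<open>1 - a\<close> and \<open>1 + a\<close> were both invertible, so would be their
  product \<open>1 - a\<^sup>2\<close>.
\<close>

lemma norm_mem_cstar_spectrum:
  fixes a :: "'a::unital_cstar_algebra"
  assumes sa: "star a = a"
  shows "complex_of_real (norm a) \<in> cstar_spectrum a \<or> complex_of_real (- norm a) \<in> cstar_spectrum a"
proof (cases "a = 0")
  case True
  have "\<not> has_inverse (0::'a)" by (simp add: has_inverse_def)
  then show ?thesis using True
    by (simp add: mem_cstar_spectrum flip: scaleR_scaleC)
      (metis of_real_0 scaleR_scaleC scaleR_zero_left)
next
  case False
  define n where "n = norm a"
  have n: "n > 0" using False by (simp add: n_def)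
  show ?thesis
  proof (rule ccontr)
    assume "\<not> ?thesis"
    then have "has_inverse (n *\<^sub>R 1 - a)" "has_inverse ((- n) *\<^sub>R 1 - a)"
      unfolding mem_cstar_spectrum n_def scaleR_scaleC by auto
    moreover have "(- n) *\<^sub>R 1 - a = - (n *\<^sub>R 1 + a)" by simp
    ultimately have "has_inverse ((n *\<^sub>R 1 - a) * (n *\<^sub>R 1 + a))"
      by (metis has_inverse_minus_iff has_inverse_mult)
    also have "(n *\<^sub>R 1 - a) * (n *\<^sub>R 1 + a) = (n * n) *\<^sub>R 1 - a * a"
      by (simp add: algebra_simps)
    finally have "has_inverse ((1/(n*n)) *\<^sub>R ((n * n) *\<^sub>R 1 - a * a))"
      using n by (intro has_inverse_scaleR) auto
    also have "(1/(n*n)) *\<^sub>R ((n * n) *\<^sub>R 1 - a * a) = 1 - ((1/n) *\<^sub>R a) * ((1/n) *\<^sub>R a)"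
      using n by (simp add: scaleR_diff_right)
    finally have "has_inverse (1 - ((1/n) *\<^sub>R a) * ((1/n) *\<^sub>R a))" .
    moreover have "star ((1/n) *\<^sub>R a) = (1/n) *\<^sub>R a" "norm ((1/n) *\<^sub>R a) = 1"
      using n by (simp_all add: star_scaleR sa n_def)
    ultimately show False using not_has_inverse_one_minus_square by blast
  qed
qed

section \<open>The positive cone\<close>

lemma cstar_positive_selfadjoint: "cstar_positive a \<Longrightarrow> star a = a"
  by (simp add: cstar_positive_def)

lemma cstar_positive_spectrum_real:
  "cstar_positive a \<Longrightarrow> complex_of_real s \<in> cstar_spectrum a \<Longrightarrow> 0 \<le> s"
  by (auto simp: cstar_positive_def)

lemma cstar_positiveI_real:
  fixes a :: "'a::unital_cstar_algebra"
  assumes "star a = a" "\<And>s. complex_of_real s \<in> cstar_spectrum a \<Longrightarrow> 0 \<le> s"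
  shows "cstar_positive a"
  unfolding cstar_positive_def
proof (intro conjI ballI)
  fix z assume z: "z \<in> cstar_spectrum a"
  then have "complex_of_real (Re z) = z"
    using selfadjoint_spectrum_real[OF assms(1)] by (simp add: complex_eq_iff)
  then show "z \<in> \<real>" "0 \<le> Re z"
    using assms(2)[of "Re z"] z Reals_of_real[of "Re z", where 'a=complex] by simp_all
qed fact

text \<open>
  This lemma and \<open>cstar_positive_norm_le\<close> together replace the spectral condition by a norm
  condition on a self-adjoint \<open>a\<close>: it is positive iff \<open>norm (t - a) \<le> t\<close> for one, equivalently
  every, \<open>t \<ge> norm a\<close>. In this form positivity passes to sums and to integrals.
\<close>

lemma cstar_positiveI_norm:
  fixes a :: "'a::unital_cstar_algebra"
  assumes sa: "star a = a" and le: "norm (t *\<^sub>R 1 - a) \<le> t"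
  shows "cstar_positive a"
proof (rule cstar_positiveI_real[OF sa])
  fix s assume "complex_of_real s \<in> cstar_spectrum a"
  then have "cmod (complex_of_real (t - s)) \<le> norm (t *\<^sub>R 1 - a)"
    using cstar_spectrum_diff_real cstar_spectrum_norm_le by blast
  then have "\<bar>t - s\<bar> \<le> norm (t *\<^sub>R 1 - a)" by (simp only: norm_of_real)
  then show "0 \<le> s" using le by simp
qed

text \<open>
  The norm of \<open>t - a\<close> occurs, up to sign, in its spectrum, which is the reflection of the spectrum
  of \<open>a\<close>. With the positive sign, \<open>t - norm (t - a)\<close> is a spectral value of \<open>a\<close>, hence \<open>\<ge> 0\<close>. With
  the negative sign, \<open>t + norm (t - a)\<close> is one, hence \<open>\<le> norm a \<le> t\<close>.
\<close>

lemma cstar_positive_norm_le: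
  fixes a :: "'a::unital_cstar_algebra"
  assumes pos: "cstar_positive a" and t: "norm a \<le> t"
  shows "norm (t *\<^sub>R 1 - a) \<le> t"
proof -
  define n where "n = norm (t *\<^sub>R 1 - a)"
  have "star (t *\<^sub>R 1 - a) = t *\<^sub>R 1 - a"
    using pos by (simp add: star_diff star_scaleR star_one cstar_positive_selfadjoint)
  from norm_mem_cstar_spectrum[OF this]
  have "complex_of_real (t - (t - n)) \<in> cstar_spectrum (t *\<^sub>R 1 - a) \<or>
      complex_of_real (t - (t + n)) \<in> cstar_spectrum (t *\<^sub>R 1 - a)"
    by (simp add: n_def)
  then consider "complex_of_real (t - n) \<in> cstar_spectrum a"
    | "complex_of_real (t + n) \<in> cstar_spectrum a"
    unfolding cstar_spectrum_diff_real by blast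
  then show ?thesis
  proof cases
    case 1
    then have "0 \<le> t - n" by (rule cstar_positive_spectrum_real[OF pos])
    then show ?thesis by (simp add: n_def)
  next
    case 2
    then have "\<bar>t + n\<bar> \<le> norm a" using cstar_spectrum_norm_le[OF 2] by (simp only: norm_of_real)
    moreover have "0 \<le> n" by (simp add: n_def)
    ultimately show ?thesis using t by (simp add: n_def)
  qed
qed

lemma cstar_positive_zero: "cstar_positive 0"
  by (rule cstar_positiveI_norm[where t=0]) (auto simp: star_zero)

lemma cstar_positive_add:
  fixes a b :: "'a::unital_cstar_algebra"
  assumes "cstar_positive a" "cstar_positive b" shows "cstar_positive (a + b)"
proof (rule cstar_positiveI_norm)
  show "star (a + b) = a + b" using assms by (simp add: star_add cstar_positive_selfadjoint)
  have "norm ((norm a + norm b) *\<^sub>R 1 - (a + b))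
      = norm ((norm a *\<^sub>R 1 - a) + (norm b *\<^sub>R 1 - b))"
    by (simp add: scaleR_add_left algebra_simps)
  also have "\<dots> \<le> norm a + norm b"
    by (intro norm_triangle_mono cstar_positive_norm_le assms) auto
  finally show "norm ((norm a + norm b) *\<^sub>R 1 - (a + b)) \<le> norm a + norm b" .
qed

lemma cstar_positive_scaleR:
  fixes a :: "'a::unital_cstar_algebra"
  assumes "cstar_positive a" "0 \<le> r" shows "cstar_positive (r *\<^sub>R a)"
proof (rule cstar_positiveI_norm)
  show "star (r *\<^sub>R a) = r *\<^sub>R a" using assms by (simp add: star_scaleR cstar_positive_selfadjoint)
  have "norm ((r * norm a) *\<^sub>R 1 - r *\<^sub>R a) = norm (r *\<^sub>R (norm a *\<^sub>R 1 - a))"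
    by (simp add: scaleR_diff_right)
  also have "\<dots> = r * norm (norm a *\<^sub>R 1 - a)" using assms by simp
  also have "\<dots> \<le> r * norm a"
    by (intro mult_left_mono cstar_positive_norm_le assms) auto
  finally show "norm ((r * norm a) *\<^sub>R 1 - r *\<^sub>R a) \<le> r * norm a" .
qed

lemma cstar_positive_norm_minus:
  fixes a :: "'a::unital_cstar_algebra"
  assumes "star a = a" "norm a \<le> t" shows "cstar_positive (t *\<^sub>R 1 - a)"
  by (rule cstar_positiveI_norm[where t=t])
    (use assms in \<open>auto simp: star_diff star_scaleR star_one\<close>)

lemma cstar_positive_square:
  fixes h :: "'a::unital_cstar_algebra"
  assumes sa: "star h = h" shows "cstar_positive (h * h)"
proof (cases "h = 0")
  case False
  define e where "e = (1 / norm h) *\<^sub>R h"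
  have e: "star e = e" "norm e = 1" using False by (simp_all add: e_def star_scaleR sa)
  then have nf: "norm (e * e) \<le> 1" by (simp add: norm_square_selfadjoint)
  have saf: "star (e * e) = e * e" by (simp add: star_mult e)
  obtain r where r: "r * r = 1 - e * e" "\<And>y. y * (e * e) = e * e * y \<Longrightarrow> y * r = r * y" "star r = r"
    using sqrt_one_minus[OF nf] saf by metis
  have "e * r = r * e" by (rule r(2)) (simp add: mult.assoc)
  then have "norm (r * r) \<le> norm (r * r + e * e)"
    using r(3) e by (intro norm_square_le_norm_sum_squares) auto
  then have "norm (1 *\<^sub>R 1 - e * e) \<le> 1" by (simp add: r(1))
  then have "cstar_positive ((norm h)\<^sup>2 *\<^sub>R (e * e))"
    by (intro cstar_positive_scaleR cstar_positiveI_norm[OF saf, of 1]) auto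
  then show ?thesis using False by (simp add: e_def power2_eq_square)
qed (simp add: cstar_positive_zero)

text \<open>
  With \<open>n = norm a\<close>, the binomial series applies to \<open>x = 1 - a/n\<close>, whose norm is at most \<open>1\<close>
  because \<open>a\<close> is positive.
\<close>

lemma cstar_positive_sqrt:
  fixes a :: "'a::unital_cstar_algebra"
  assumes pos: "cstar_positive a"
  obtains h where "star h = h" "h * h = a" "\<And>y. y * a = a * y \<Longrightarrow> y * h = h * y"
proof (cases "a = 0")
  case True
  then show ?thesis using that[of 0] by (simp add: star_zero)
next
  case False
  define n where "n = norm a"
  have n: "n > 0" using False by (simp add: n_def)
  define x where "x = 1 - (1/n) *\<^sub>R a"
  have sax: "star x = x"
    using pos by (simp add: x_def star_diff star_scaleR star_one cstar_positive_selfadjoint)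
  have "norm x = norm ((1/n) *\<^sub>R (n *\<^sub>R 1 - a))"
    using n by (simp add: x_def scaleR_diff_right)
  also have "\<dots> = (1/n) * norm (n *\<^sub>R 1 - a)" using n by simp
  also have "\<dots> \<le> (1/n) * n"
    using n by (intro mult_left_mono cstar_positive_norm_le pos) (auto simp: n_def)
  finally have "norm x \<le> 1" using n by simp
  then obtain r where r: "r * r = 1 - x" "\<And>y. y * x = x * y \<Longrightarrow> y * r = r * y" "star r = r"
    using sqrt_one_minus[of x] sax by metis
  show ?thesis
  proof
    show "star (sqrt n *\<^sub>R r) = sqrt n *\<^sub>R r" by (simp add: star_scaleR r)
    show "(sqrt n *\<^sub>R r) * (sqrt n *\<^sub>R r) = a" using n by (simp add: r(1) x_def)
    fix y assume "y * a = a * y"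
    then have "y * r = r * y" by (intro r(2)) (simp add: x_def algebra_simps)
    then show "y * (sqrt n *\<^sub>R r) = sqrt n *\<^sub>R r * y" by simp
  qed
qed

text \<open>
  From \<open>a \<le> b \<le> norm b\<close> the spectrum of \<open>a\<close> lies in \<open>[0, norm b]\<close>, and it contains \<open>norm a\<close> unless
  \<open>a = 0\<close>.
\<close>

lemma cstar_positive_norm_mono:
  fixes a b :: "'a::unital_cstar_algebra"
  assumes a: "cstar_positive a" and le: "a \<sqsubseteq> b" shows "norm a \<le> norm b"
proof -
  have ba: "cstar_positive (b - a)" using le by (simp add: cstar_le_def)
  then have "cstar_positive b" using cstar_positive_add[OF a ba] by simp
  then have "cstar_positive ((norm b *\<^sub>R 1 - b) + (b - a))"
    by (intro cstar_positive_add ba cstar_positive_norm_minus cstar_positive_selfadjoint) auto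
  then have diff: "cstar_positive (norm b *\<^sub>R 1 - a)" by simp
  show ?thesis
    using norm_mem_cstar_spectrum[OF cstar_positive_selfadjoint[OF a]]
  proof
    assume "complex_of_real (norm a) \<in> cstar_spectrum a"
    then show ?thesis
      using cstar_spectrum_diff_real cstar_positive_spectrum_real[OF diff] by fastforce
  next
    assume "complex_of_real (- norm a) \<in> cstar_spectrum a"
    then have "norm a \<le> 0" using cstar_positive_spectrum_real[OF a] by fastforce
    then show ?thesis using norm_ge_zero[of b] by linarith
  qed
qed

lemma cstar_positive_has_inverse:
  fixes a :: "'a::unital_cstar_algebra"
  assumes "cstar_positive a" "0 < s" shows "has_inverse (a + s *\<^sub>R 1)"
proof -
  have "complex_of_real (- s) \<notin> cstar_spectrum a"
    using cstar_positive_spectrum_real[OF assms(1), of "- s"] assms(2) by auto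
  then have "has_inverse (scaleC (complex_of_real (- s)) 1 - a)"
    by (simp add: mem_cstar_spectrum)
  moreover have "scaleC (complex_of_real (- s)) 1 - a = - (a + s *\<^sub>R 1)"
    unfolding scaleR_scaleC[symmetric] by simp
  ultimately show ?thesis by (metis has_inverse_minus_iff)
qed

text \<open>
  A self-adjoint element has real spectrum, so only the negative reals have to be excluded.
\<close>

lemma cstar_positiveI_shifted:
  fixes a :: "'a::unital_cstar_algebra"
  assumes sa: "star a = a" and inv: "\<And>s. 0 < s \<Longrightarrow> has_inverse (a + s *\<^sub>R 1)"
  shows "cstar_positive a"
proof (rule cstar_positiveI_real[OF sa], rule ccontr)
  fix s assume s: "complex_of_real s \<in> cstar_spectrum a" "\<not> 0 \<le> s"
  then have "has_inverse (- (a + (- s) *\<^sub>R 1))" using inv[of "- s"] by (simp only: has_inverse_minus_iff)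
  then have "has_inverse (scaleC (complex_of_real s) 1 - a)"
    unfolding scaleR_scaleC[symmetric] by simp
  then show False using s by (simp add: mem_cstar_spectrum)
qed

lemma cstar_positive_closed:
  fixes a :: "'a::unital_cstar_algebra"
  assumes pos: "\<And>s. 0 < s \<Longrightarrow> cstar_positive (a + s *\<^sub>R 1)"
  shows "cstar_positive a"
proof (rule cstar_positiveI_shifted)
  have "star (a + 1 *\<^sub>R 1) = a + 1 *\<^sub>R 1" using pos[of 1] cstar_positive_selfadjoint by force
  then show "star a = a" by (simp add: star_add star_one)
  fix s :: real assume "0 < s"
  then have "has_inverse ((a + (s/2) *\<^sub>R 1) + (s/2) *\<^sub>R 1)"
    by (intro cstar_positive_has_inverse pos) auto
  then show "has_inverse (a + s *\<^sub>R 1)"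
    by (simp add: add.assoc flip: scaleR_add_left)
qed

text \<open>
  The square of an invertible self-adjoint \<open>s\<close> is bounded below by a positive scalar: with
  \<open>k\<close> the inverse of \<open>s\<close>, \<open>N = norm k\<close> and \<open>m\<close> the root of \<open>N\<^sup>2 - k\<^sup>2\<close>, one has
  \<open>s\<^sup>2 = (1 + (s m)\<^sup>2) / N\<^sup>2\<close>.
\<close>

lemma has_inverse_positive_add_square:
  fixes c s k :: "'a::unital_cstar_algebra"
  assumes c: "cstar_positive c" and sa: "star s = s" and inv: "k * s = 1" "s * k = 1"
  shows "has_inverse (c + s * s)"
proof -
  have sak: "star k = k" by (rule inverse_selfadjoint[OF inv sa])
  define N where "N = norm k"
  have "k \<noteq> 0" using inv by auto
  then have N: "N > 0" by (simp add: N_def)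
  have "cstar_positive (N\<^sup>2 *\<^sub>R 1 - k * k)"
    by (rule cstar_positive_norm_minus) (simp_all add: star_mult sak norm_square_selfadjoint N_def)
  then obtain m where m: "star m = m" "m * m = N\<^sup>2 *\<^sub>R 1 - k * k"
      "\<And>y. y * (N\<^sup>2 *\<^sub>R 1 - k * k) = (N\<^sup>2 *\<^sub>R 1 - k * k) * y \<Longrightarrow> y * m = m * y"
    using cstar_positive_sqrt by blast
  have sm: "s * m = m * s"
    by (rule m(3)) (simp add: algebra_simps inv, metis inv mult.assoc mult_1_left mult_1_right)
  have "(s * m) * (s * m) = (s * m) * (m * s)" using sm by simp
  also have "\<dots> = s * (m * m) * s" by (simp add: mult.assoc)
  also have "\<dots> = N\<^sup>2 *\<^sub>R (s * s) - (s * k) * (k * s)"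
    unfolding m(2) by (simp add: algebra_simps)
  finally have sq: "(s * m) * (s * m) = N\<^sup>2 *\<^sub>R (s * s) - 1" by (simp add: inv)
  have "cstar_positive ((s * m) * (s * m))"
    by (rule cstar_positive_square) (simp add: star_mult sa m sm)
  then have "cstar_positive (c + (1/N\<^sup>2) *\<^sub>R ((s * m) * (s * m)))"
    by (intro cstar_positive_add c cstar_positive_scaleR) auto
  then have "has_inverse (c + (1/N\<^sup>2) *\<^sub>R ((s * m) * (s * m)) + (1/N\<^sup>2) *\<^sub>R 1)"
    using N by (intro cstar_positive_has_inverse) auto
  then show ?thesis unfolding sq using N by (simp add: scaleR_diff_right)
qed

text \<open>
  For arbitrary \<open>k\<close> this rests on the theorem that all \<open>star y * y\<close> are positive. For
  invertible self-adjoint \<open>k\<close>, with inverse \<open>h\<close>, it is elementary: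
  \<open>k c k + s = k (c + s h\<^sup>2) k\<close> is invertible for every \<open>s > 0\<close>.
\<close>

lemma cstar_positive_conj_invertible:
  fixes c h k :: "'a::unital_cstar_algebra"
  assumes c: "cstar_positive c" and sa: "star k = k" and inv: "h * k = 1" "k * h = 1"
  shows "cstar_positive (k * c * k)"
proof (rule cstar_positiveI_shifted)
  show "star (k * c * k) = k * c * k"
    using c by (simp add: star_mult sa cstar_positive_selfadjoint mult.assoc)
  fix s :: real assume s: "0 < s"
  have sah: "star h = h" by (rule inverse_selfadjoint[OF inv sa])
  define u where "u = sqrt s *\<^sub>R h"
  have "has_inverse (c + u * u)"
  proof (rule has_inverse_positive_add_square[OF c])
    show "star u = u" by (simp add: u_def star_scaleR sah)
    show "((1 / sqrt s) *\<^sub>R k) * u = 1" "u * ((1 / sqrt s) *\<^sub>R k) = 1"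
      using s inv by (simp_all add: u_def)
  qed
  moreover have "has_inverse k" unfolding has_inverse_def using inv by blast
  ultimately have "has_inverse (k * (c + u * u) * k)" by (intro has_inverse_mult)
  also have "k * (c + u * u) * k = k * c * k + s *\<^sub>R ((k * h) * (h * k))"
    using s by (simp add: u_def algebra_simps)
  finally show "has_inverse (k * c * k + s *\<^sub>R 1)" by (simp add: inv)
qed

section \<open>From norm inequalities to order inequalities\<close>

text \<open>
  A comparison of norms says little about order, but it does if it is stable under conjugation.
  Choose \<open>h = (q + e) powr (-1/2)\<close>. Then \<open>h q h \<le> h (q + e) h = 1\<close>, so the norm of \<open>h p h\<close> is at most
  \<open>C\<close>, which for a self-adjoint element means \<open>h p h \<le> C\<close>. Conjugation with \<open>k\<close>, the inverse of \<open>h\<close>,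
  turns this into \<open>p \<le> C (q + e)\<close>, and \<open>e\<close> tends to \<open>0\<close>.
\<close>

lemma cstar_le_scaleR_if_norm_conj_le:
  fixes p q :: "'a::unital_cstar_algebra"
  assumes sap: "star p = p" and q: "cstar_positive q" and C: "0 \<le> C"
    and le: "\<And>h. star h = h \<Longrightarrow> norm (h * p * h) \<le> C * norm (h * q * h)"
  shows "p \<sqsubseteq> C *\<^sub>R q"
proof -
  have approx: "cstar_positive (C *\<^sub>R (q + e *\<^sub>R 1) - p)" if e: "0 < e" for e :: real
  proof -
    define b where "b = q + e *\<^sub>R 1"
    have "cstar_positive (e *\<^sub>R (1 * 1 :: 'a))"
      using e by (intro cstar_positive_scaleR cstar_positive_square) (auto simp: star_one)
    then have b: "cstar_positive b" using q by (simp add: b_def cstar_positive_add)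
    obtain k where k: "star k = k" "k * k = b" "\<And>y. y * b = b * y \<Longrightarrow> y * k = k * y"
      using cstar_positive_sqrt[OF b] by blast
    obtain m where m: "star m = m" "m * m = q" "\<And>y. y * q = q * y \<Longrightarrow> y * m = m * y"
      using cstar_positive_sqrt[OF q] by blast
    obtain d where d: "d * b = 1" "b * d = 1"
      using cstar_positive_has_inverse[OF q e] unfolding has_inverse_def b_def by blast
    define h where "h = d * k"
    have hk: "h * k = 1" by (simp add: h_def mult.assoc k(2) d(1))
    have "k * d = d * k" by (rule inverse_commutes[OF d]) (simp add: k(2)[symmetric] mult.assoc)
    then have "k * h = (d * k) * k" by (simp add: h_def flip: mult.assoc)
    then have kh: "k * h = 1" using hk by (simp add: h_def)
    have sah: "star h = h" by (rule inverse_selfadjoint[OF hk kh k(1)])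
    have "q * k = k * q" by (rule k(3)) (simp add: b_def algebra_simps)
    then have "k * m = m * k" by (intro m(3)) simp
    then have hm: "h * m = m * h" using inverse_commutes[OF hk kh, of m] by simp
    \<comment> \<open>\<open>h q h\<close> and \<open>e h\<^sup>2\<close> are squares of commuting elements with sum \<open>h b h = 1\<close>.\<close>
    define u where "u = sqrt e *\<^sub>R h"
    have "h * q * h = (h * m) * (m * h)" by (simp add: m(2)[symmetric] mult.assoc)
    then have "h * q * h = (h * m) * (h * m)" using hm by simp
    moreover have "norm ((h * m) * (h * m)) \<le> norm ((h * m) * (h * m) + u * u)"
    proof (rule norm_square_le_norm_sum_squares)
      show "star (h * m) = h * m" "star u = u"
        by (simp_all add: star_mult u_def star_scaleR sah m(1) hm)
      have "h * m * h = h * (h * m)" using hm by (metis mult.assoc)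
      then show "h * m * u = u * (h * m)" by (simp add: u_def)
    qed
    moreover have "h * q * h + u * u = h * b * h"
      using e by (simp add: b_def u_def algebra_simps)
    moreover have "h * b * h = (h * k) * (k * h)" by (simp add: k(2)[symmetric] mult.assoc)
    ultimately have "norm (h * q * h) \<le> 1" using hk kh by simp
    then have "norm (h * p * h) \<le> C"
      using le[OF sah] mult_left_mono[OF _ C, of "norm (h * q * h)" 1] by simp
    then have "cstar_positive (C *\<^sub>R 1 - h * p * h)"
      by (intro cstar_positive_norm_minus) (simp_all add: star_mult sah sap mult.assoc)
    then have "cstar_positive (k * (C *\<^sub>R 1 - h * p * h) * k)"
      by (rule cstar_positive_conj_invertible[OF _ k(1) hk kh])
    also have "k * (C *\<^sub>R 1 - h * p * h) * k = C *\<^sub>R (k * k) - (k * h) * p * (h * k)"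
      by (simp add: algebra_simps)
    finally show ?thesis using hk kh k(2) by (simp add: b_def)
  qed
  have "cstar_positive (C *\<^sub>R q - p + s *\<^sub>R 1)" if s: "0 < s" for s :: real
  proof -
    \<comment> \<open>\<open>C e \<le> s\<close> is what is needed; the summand \<open>1\<close> covers \<open>C = 0\<close>.\<close>
    define e where "e = s / (C + 1)"
    have e: "0 < e" using s C by (simp add: e_def)
    have "s - C * e = e" using C by (simp add: e_def field_simps)
    have "cstar_positive (e *\<^sub>R (1 * 1 :: 'a))"
      using e by (intro cstar_positive_scaleR cstar_positive_square) (auto simp: star_one)
    then have "cstar_positive ((C *\<^sub>R (q + e *\<^sub>R 1) - p) + e *\<^sub>R 1)"
      using approx[OF e] cstar_positive_add by fastforce
    also have "(C *\<^sub>R (q + e *\<^sub>R 1) - p) + e *\<^sub>R 1 = C *\<^sub>R q - p + (C * e + e) *\<^sub>R 1"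
      by (simp add: algebra_simps)
    also have "C * e + e = s" using \<open>s - C * e = e\<close> by simp
    finally show ?thesis .
  qed
  then show ?thesis unfolding cstar_le_def by (rule cstar_positive_closed)
qed

section \<open>The Bochner integral of strongly measurable functions\<close>

abbreviation step_integrable :: "'w measure \<Rightarrow> ('w \<Rightarrow> 'b::real_normed_vector) \<Rightarrow> bool" where
  "step_integrable \<equiv> Bochner_Integration.simple_bochner_integrable"

abbreviation step_integral :: "'w measure \<Rightarrow> ('w \<Rightarrow> 'b::real_normed_vector) \<Rightarrow> 'b" where
  "step_integral \<equiv> Bochner_Integration.simple_bochner_integral"

lemma strongly_measurable_compose:
  assumes "strongly_measurable M f" and h: "continuous_on UNIV h"
  shows "strongly_measurable M (\<lambda>w. h (f w))"
proof -
  obtain s where s: "\<And>i. simple_function M (s i)"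
    "\<And>w. w \<in> space M \<Longrightarrow> (\<lambda>i::nat. s i w) \<longlonglongrightarrow> f w"
    using assms(1) unfolding strongly_measurable_def by blast
  show ?thesis
    unfolding strongly_measurable_def
  proof (intro exI conjI allI ballI)
    show "simple_function M (\<lambda>w. h (s i w))" for i by (rule simple_function_compose1[OF s(1)])
    show "(\<lambda>i. h (s i w)) \<longlonglongrightarrow> h (f w)" if "w \<in> space M" for w
      by (rule continuous_on_tendsto_compose[OF h s(2)[OF that]]) auto
  qed
qed

lemma strongly_measurable_Pair:
  assumes "strongly_measurable M f" "strongly_measurable M g"
  shows "strongly_measurable M (\<lambda>w. (f w, g w))"
proof -
  obtain s where s: "\<And>i. simple_function M (s i)"
    "\<And>w. w \<in> space M \<Longrightarrow> (\<lambda>i::nat. s i w) \<longlonglongrightarrow> f w"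
    using assms(1) unfolding strongly_measurable_def by blast
  obtain t where t: "\<And>i. simple_function M (t i)"
    "\<And>w. w \<in> space M \<Longrightarrow> (\<lambda>i::nat. t i w) \<longlonglongrightarrow> g w"
    using assms(2) unfolding strongly_measurable_def by blast
  show ?thesis
    unfolding strongly_measurable_def
  proof (intro exI conjI allI ballI)
    show "simple_function M (\<lambda>w. (s i w, t i w))" for i
      by (rule simple_function_compose2[OF s(1) t(1)])
    show "(\<lambda>i. (s i w, t i w)) \<longlonglongrightarrow> (f w, g w)" if "w \<in> space M" for w
      by (intro tendsto_Pair s t that)
  qed
qed

lemma strongly_measurable_add:
  assumes "strongly_measurable M f" "strongly_measurable M g"
  shows "strongly_measurable M (\<lambda>w. f w + g w)"
  using strongly_measurable_compose[OF strongly_measurable_Pair[OF assms], of "\<lambda>z. fst z + snd z"]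
  by (simp add: continuous_intros)

lemma strongly_measurable_diff:
  assumes "strongly_measurable M f" "strongly_measurable M g"
  shows "strongly_measurable M (\<lambda>w. f w - g w)"
  using strongly_measurable_compose[OF strongly_measurable_Pair[OF assms], of "\<lambda>z. fst z - snd z"]
  by (simp add: continuous_intros)

lemma strongly_measurable_cong:
  "strongly_measurable M f \<Longrightarrow> (\<And>w. w \<in> space M \<Longrightarrow> f w = g w) \<Longrightarrow> strongly_measurable M g"
  unfolding strongly_measurable_def by simp

lemma strongly_measurable_simple: "simple_function M s \<Longrightarrow> strongly_measurable M s"
  unfolding strongly_measurable_def by (intro exI[of _ "\<lambda>_. s"]) auto

lemma borel_measurable_norm_strongly_measurable:
  assumes "strongly_measurable M f" shows "(\<lambda>w. norm (f w)) \<in> borel_measurable M"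
  unfolding strongly_measurable_iff_borel_measurable[symmetric]
  by (rule strongly_measurable_compose[OF assms]) (intro continuous_intros)

lemma nn_integral_norm_triangle:
  assumes "strongly_measurable M f" "strongly_measurable M g"
    and le: "\<And>w. w \<in> space M \<Longrightarrow> norm (h w) \<le> norm (f w) + norm (g w)"
  shows "(\<integral>\<^sup>+w. norm (h w) \<partial>M) \<le> (\<integral>\<^sup>+w. norm (f w) \<partial>M) + (\<integral>\<^sup>+w. norm (g w) \<partial>M)"
proof -
  note [measurable] = assms(1,2)[THEN borel_measurable_norm_strongly_measurable]
  have "(\<integral>\<^sup>+w. norm (h w) \<partial>M) \<le> (\<integral>\<^sup>+w. ennreal (norm (f w)) + ennreal (norm (g w)) \<partial>M)"
    using le by (intro nn_integral_mono) (simp flip: ennreal_plus)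
  also have "\<dots> = (\<integral>\<^sup>+w. norm (f w) \<partial>M) + (\<integral>\<^sup>+w. norm (g w) \<partial>M)"
    by (rule nn_integral_add) auto
  finally show ?thesis .
qed

lemma tendsto_zero_ennreal_le:
  fixes u v :: "nat \<Rightarrow> ennreal"
  assumes "v \<longlonglongrightarrow> 0" "\<And>i. u i \<le> v i" shows "u \<longlonglongrightarrow> 0"
  by (rule tendsto_sandwich[OF _ _ tendsto_const assms(1)]) (simp_all add: assms(2))

lemma step_integrable_strongly_measurable:
  "step_integrable M s \<Longrightarrow> strongly_measurable M s"
  by (auto elim: simple_bochner_integrable.cases intro: strongly_measurable_simple)

lemma norm_step_integral_le:
  assumes "step_integrable M s"
  shows "ennreal (norm (step_integral M s)) \<le> (\<integral>\<^sup>+w. norm (s w) \<partial>M)"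
proof -
  have "ennreal (norm (step_integral M s)) \<le> step_integral M (\<lambda>w. norm (s w))"
    by (intro ennreal_leI simple_bochner_integral_norm_bound assms)
  also have "\<dots> = (\<integral>\<^sup>+w. norm (s w) \<partial>M)"
    by (intro simple_bochner_integral_eq_nn_integral simple_bochner_integrable_compose2[of "\<lambda>x _. norm x", OF _ assms assms])
      auto
  finally show ?thesis .
qed

text \<open>
  The one estimate behind uniqueness, existence and continuity of the integral: integrals of
  approximating step functions are as close as the functions that they approximate.
\<close>

lemma step_integral_dist_le:
  assumes f: "strongly_measurable M f" and g: "strongly_measurable M g"
    and s: "step_integrable M s" and t: "step_integrable M t"
  shows "ennreal (norm (step_integral M s - step_integral M t))
    \<le> ((\<integral>\<^sup>+w. norm (f w - s w) \<partial>M) + (\<integral>\<^sup>+w. norm (g w - t w) \<partial>M)) + (\<integral>\<^sup>+w. norm (f w - g w) \<partial>M)"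
proof -
  note sm = s[THEN step_integrable_strongly_measurable] t[THEN step_integrable_strongly_measurable]
  have "step_integral M s - step_integral M t = step_integral M (\<lambda>w. s w - t w)"
    using s t by (simp add: simple_bochner_integral_diff)
  then have "ennreal (norm (step_integral M s - step_integral M t))
      \<le> (\<integral>\<^sup>+w. norm (s w - t w) \<partial>M)"
    using norm_step_integral_le[OF simple_bochner_integrable_compose2[of "(-)", OF _ s t]] by simp
  also have "\<dots> \<le> (\<integral>\<^sup>+w. norm (f w - s w) \<partial>M) + (\<integral>\<^sup>+w. norm (f w - t w) \<partial>M)"
    by (intro nn_integral_norm_triangle strongly_measurable_diff f sm)
      (metis norm_diff_triangle_le norm_minus_commute order_refl)
  also have "\<dots> \<le> (\<integral>\<^sup>+w. norm (f w - s w) \<partial>M) + ((\<integral>\<^sup>+w. norm (g w - t w) \<partial>M) + (\<integral>\<^sup>+w. norm (f w - g w) \<partial>M))"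
    by (intro add_left_mono nn_integral_norm_triangle strongly_measurable_diff f g sm)
      (metis norm_diff_triangle_le add.commute order_refl)
  finally show ?thesis by (simp add: add.assoc)
qed

lemma has_strong_integralE:
  assumes "has_strong_integral M f I"
  obtains s where "strongly_measurable M f" "\<And>i::nat. step_integrable M (s i)"
    "(\<lambda>i. \<integral>\<^sup>+w. norm (f w - s i w) \<partial>M) \<longlonglongrightarrow> 0" "(\<lambda>i. step_integral M (s i)) \<longlonglongrightarrow> I"
  using assms unfolding has_strong_integral_def by blast

lemma has_strong_integralI:
  assumes "strongly_measurable M f" "\<And>i::nat. step_integrable M (s i)"
    "(\<lambda>i. \<integral>\<^sup>+w. norm (f w - s i w) \<partial>M) \<longlonglongrightarrow> 0" "(\<lambda>i. step_integral M (s i)) \<longlonglongrightarrow> I"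
  shows "has_strong_integral M f I"
  using assms unfolding has_strong_integral_def by blast

lemma has_strong_integral_cong:
  assumes "has_strong_integral M f I" and eq: "\<And>w. w \<in> space M \<Longrightarrow> f w = g w"
  shows "has_strong_integral M g I"
proof -
  obtain s where s: "strongly_measurable M f" "\<And>i::nat. step_integrable M (s i)"
    "(\<lambda>i. \<integral>\<^sup>+w. norm (f w - s i w) \<partial>M) \<longlonglongrightarrow> 0" "(\<lambda>i. step_integral M (s i)) \<longlonglongrightarrow> I"
    using assms(1) unfolding has_strong_integral_def by blast
  have "(\<integral>\<^sup>+w. norm (g w - s i w) \<partial>M) = (\<integral>\<^sup>+w. norm (f w - s i w) \<partial>M)" for i
    using eq by (intro nn_integral_cong) simp
  with s show ?thesis
    by (intro has_strong_integralI[of M g s] strongly_measurable_cong[OF s(1) eq]) auto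
qed

lemma has_strong_integral_dist_le:
  assumes f: "has_strong_integral M f I" and g: "has_strong_integral M g J"
  shows "ennreal (norm (I - J)) \<le> (\<integral>\<^sup>+w. norm (f w - g w) \<partial>M)"
proof -
  obtain s where s: "strongly_measurable M f" "\<And>i::nat. step_integrable M (s i)"
    "(\<lambda>i. \<integral>\<^sup>+w. norm (f w - s i w) \<partial>M) \<longlonglongrightarrow> 0" "(\<lambda>i. step_integral M (s i)) \<longlonglongrightarrow> I"
    using f unfolding has_strong_integral_def by blast
  obtain t where t: "strongly_measurable M g" "\<And>i::nat. step_integrable M (t i)"
    "(\<lambda>i. \<integral>\<^sup>+w. norm (g w - t i w) \<partial>M) \<longlonglongrightarrow> 0" "(\<lambda>i. step_integral M (t i)) \<longlonglongrightarrow> J"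
    using g unfolding has_strong_integral_def by blast
  show ?thesis
  proof (rule LIMSEQ_le)
    show "(\<lambda>i. ennreal (norm (step_integral M (s i) - step_integral M (t i))))
        \<longlonglongrightarrow> ennreal (norm (I - J))"
      by (intro tendsto_ennrealI tendsto_norm tendsto_diff s t)
    show "(\<lambda>i. ((\<integral>\<^sup>+w. norm (f w - s i w) \<partial>M) + (\<integral>\<^sup>+w. norm (g w - t i w) \<partial>M))
        + (\<integral>\<^sup>+w. norm (f w - g w) \<partial>M)) \<longlonglongrightarrow> (\<integral>\<^sup>+w. norm (f w - g w) \<partial>M)"
      using tendsto_add[OF tendsto_add[OF s(3) t(3)] tendsto_const[of "\<integral>\<^sup>+w. norm (f w - g w) \<partial>M"]]
      by simp
  qed (intro exI allI impI step_integral_dist_le s t)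
qed

lemma has_strong_integral_unique:
  assumes "has_strong_integral M f I" "has_strong_integral M f J" shows "I = J"
  using has_strong_integral_dist_le[OF assms] by simp

lemma strong_integral_eqI: "has_strong_integral M f I \<Longrightarrow> strong_integral M f = I"
  unfolding strong_integral_def by (rule the_equality) (auto intro: has_strong_integral_unique)

lemma has_strong_integral_strong_integral:
  "strong_integrable M f \<Longrightarrow> has_strong_integral M f (strong_integral M f)"
  unfolding strong_integrable_def using strong_integral_eqI by blast

lemma has_strong_integral_finite_norm:
  assumes "has_strong_integral M f I" shows "(\<integral>\<^sup>+w. norm (f w) \<partial>M) < \<infinity>"
proof -
  obtain s where s: "strongly_measurable M f" "\<And>i::nat. step_integrable M (s i)"
    "(\<lambda>i. \<integral>\<^sup>+w. norm (f w - s i w) \<partial>M) \<longlonglongrightarrow> 0"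
    using assms unfolding has_strong_integral_def by blast
  obtain i where i: "(\<integral>\<^sup>+w. norm (f w - s i w) \<partial>M) < \<infinity>"
    using order_tendstoD(2)[OF s(3), of \<infinity>] by (auto simp: eventually_sequentially)
  have "(\<integral>\<^sup>+w. norm (s i w) \<partial>M) = step_integral M (\<lambda>w. norm (s i w))"
    by (intro simple_bochner_integral_eq_nn_integral[symmetric]
        simple_bochner_integrable_compose2[of "\<lambda>x _. norm x", OF _ s(2) s(2)]) auto
  then have "(\<integral>\<^sup>+w. norm (s i w) \<partial>M) < \<infinity>" by simp
  moreover have "(\<integral>\<^sup>+w. norm (f w) \<partial>M) \<le> (\<integral>\<^sup>+w. norm (f w - s i w) \<partial>M) + (\<integral>\<^sup>+w. norm (s i w) \<partial>M)"
    using s(1) s(2)[THEN step_integrable_strongly_measurable]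
    by (intro nn_integral_norm_triangle strongly_measurable_diff)
      (metis add.commute norm_triangle_sub)+
  ultimately show ?thesis using i by (simp add: order_le_less_trans)
qed

lemma has_strong_integral_bounded_linear:
  assumes L: "bounded_linear L" and f: "has_strong_integral M f I"
  shows "has_strong_integral M (\<lambda>w. L (f w)) (L I)"
proof -
  interpret bounded_linear L by fact
  obtain s where s: "strongly_measurable M f" "\<And>i::nat. step_integrable M (s i)"
    "(\<lambda>i. \<integral>\<^sup>+w. norm (f w - s i w) \<partial>M) \<longlonglongrightarrow> 0" "(\<lambda>i. step_integral M (s i)) \<longlonglongrightarrow> I"
    using f unfolding has_strong_integral_def by blast
  obtain C where C: "0 < C" "\<And>x. norm (L x) \<le> norm x * C" using pos_bounded by blast
  have le: "(\<integral>\<^sup>+w. norm (L (f w) - L (s i w)) \<partial>M) \<le> ennreal C * (\<integral>\<^sup>+w. norm (f w - s i w) \<partial>M)" for i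
  proof -
    have [measurable]: "(\<lambda>w. norm (f w - s i w)) \<in> borel_measurable M"
      using s(1) s(2)[THEN step_integrable_strongly_measurable]
      by (intro borel_measurable_norm_strongly_measurable strongly_measurable_diff)
    have "(\<integral>\<^sup>+w. norm (L (f w) - L (s i w)) \<partial>M) \<le> (\<integral>\<^sup>+w. ennreal C * norm (f w - s i w) \<partial>M)"
      using C by (intro nn_integral_mono) (simp add: ennreal_mult[symmetric] mult.commute flip: diff)
    also have "\<dots> = ennreal C * (\<integral>\<^sup>+w. norm (f w - s i w) \<partial>M)"
      by (rule nn_integral_cmult) auto
    finally show ?thesis .
  qed
  have "(\<lambda>i. ennreal C * (\<integral>\<^sup>+w. norm (f w - s i w) \<partial>M)) \<longlonglongrightarrow> 0"
    using tendsto_mult_ennreal[OF tendsto_const s(3), of "ennreal C"] by simp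
  then have "(\<lambda>i. \<integral>\<^sup>+w. norm (L (f w) - L (s i w)) \<partial>M) \<longlonglongrightarrow> 0"
    using le by (rule tendsto_zero_ennreal_le)
  moreover have "step_integrable M (\<lambda>w. L (s i w))" for i
    by (rule simple_bochner_integrable_compose2[of "\<lambda>x _. L x", OF _ s(2) s(2)]) (simp add: zero)
  moreover have "(\<lambda>i. step_integral M (\<lambda>w. L (s i w))) \<longlonglongrightarrow> L I"
    unfolding simple_bochner_integral_linear[OF linear s(2)] by (rule tendsto[OF s(4)])
  moreover have "strongly_measurable M (\<lambda>w. L (f w))"
    by (rule strongly_measurable_compose[OF s(1)]) (rule linear_continuous_on[OF L])
  ultimately show ?thesis by (intro has_strong_integralI[of M _ "\<lambda>i w. L (s i w)"])
qed

lemma has_strong_integral_add: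
  assumes f: "has_strong_integral M f I" and g: "has_strong_integral M g J"
  shows "has_strong_integral M (\<lambda>w. f w + g w) (I + J)"
proof -
  obtain s where s: "strongly_measurable M f" "\<And>i::nat. step_integrable M (s i)"
    "(\<lambda>i. \<integral>\<^sup>+w. norm (f w - s i w) \<partial>M) \<longlonglongrightarrow> 0" "(\<lambda>i. step_integral M (s i)) \<longlonglongrightarrow> I"
    using f unfolding has_strong_integral_def by blast
  obtain t where t: "strongly_measurable M g" "\<And>i::nat. step_integrable M (t i)"
    "(\<lambda>i. \<integral>\<^sup>+w. norm (g w - t i w) \<partial>M) \<longlonglongrightarrow> 0" "(\<lambda>i. step_integral M (t i)) \<longlonglongrightarrow> J"
    using g unfolding has_strong_integral_def by blast
  note sm = s(2)[THEN step_integrable_strongly_measurable]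
    t(2)[THEN step_integrable_strongly_measurable]
  have "(\<integral>\<^sup>+w. norm (f w + g w - (s i w + t i w)) \<partial>M)
      \<le> (\<integral>\<^sup>+w. norm (f w - s i w) \<partial>M) + (\<integral>\<^sup>+w. norm (g w - t i w) \<partial>M)" for i
    by (intro nn_integral_norm_triangle strongly_measurable_diff s t sm norm_diff_triangle_ineq)
  then have lim: "(\<lambda>i. \<integral>\<^sup>+w. norm (f w + g w - (s i w + t i w)) \<partial>M) \<longlonglongrightarrow> 0"
    by (rule tendsto_zero_ennreal_le[OF tendsto_add[OF s(3) t(3), unfolded add_0_left]])
  have int: "step_integrable M (\<lambda>w. s i w + t i w)" for i
    by (rule simple_bochner_integrable_compose2[OF _ s(2) t(2)]) simp
  have "(\<lambda>i. step_integral M (\<lambda>w. s i w + t i w)) \<longlonglongrightarrow> I + J"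
    unfolding simple_bochner_integral_add[OF s(2) t(2)] by (intro tendsto_add s t)
  then show ?thesis
    by (rule has_strong_integralI[OF strongly_measurable_add[OF s(1) t(1)] int lim])
qed

lemma has_strong_integral_diff:
  assumes "has_strong_integral M f I" "has_strong_integral M g J"
  shows "has_strong_integral M (\<lambda>w. f w - g w) (I - J)"
  using has_strong_integral_add[OF assms(1)
      has_strong_integral_bounded_linear[OF bounded_linear_minus[OF bounded_linear_ident] assms(2)]]
  by simp

lemma has_strong_integral_scaleR:
  "has_strong_integral M f I \<Longrightarrow> has_strong_integral M (\<lambda>w. r *\<^sub>R f w) (r *\<^sub>R I)"
  by (rule has_strong_integral_bounded_linear[OF bounded_linear_scaleR_right])

text \<open>
  The given simple functions converge pointwise without any domination. Cutting them off where
  their norm exceeds \<open>2 * norm (f w)\<close> keeps them simple, does not affect the limit and makes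
  dominated convergence applicable.
\<close>

lemma strong_integrableI_bounded:
  fixes f :: "'w \<Rightarrow> 'b::banach"
  assumes f: "strongly_measurable M f" and fin: "(\<integral>\<^sup>+w. norm (f w) \<partial>M) < \<infinity>"
  shows "strong_integrable M f"
proof -
  obtain s where s: "\<And>i. simple_function M (s i)"
    "\<And>w. w \<in> space M \<Longrightarrow> (\<lambda>i::nat. s i w) \<longlonglongrightarrow> f w"
    using f unfolding strongly_measurable_def by blast
  note nf [measurable] = borel_measurable_norm_strongly_measurable[OF f]
  define t where "t i w = (if norm (s i w) \<le> 2 * norm (f w) then s i w else 0)" for i w
  have [measurable]: "(\<lambda>w. norm (s i w)) \<in> borel_measurable M" for i
    by (intro borel_measurable_norm_strongly_measurable strongly_measurable_simple s)
  have t_simple: "simple_function M (t i)" for i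
    unfolding t_def by (intro simple_function_If s simple_function_const) measurable
  have t_le: "norm (t i w) \<le> 2 * norm (f w)" for i w by (simp add: t_def)
  have t_lim: "(\<lambda>i. t i w) \<longlonglongrightarrow> f w" if w: "w \<in> space M" for w
  proof (cases "f w = 0")
    case True
    then have "t i w = 0" for i by (simp add: t_def)
    then show ?thesis using True by simp
  next
    case False
    then have "norm (f w) < 2 * norm (f w)" by simp
    then have "\<forall>\<^sub>F i in sequentially. norm (s i w) < 2 * norm (f w)"
      by (rule order_tendstoD(2)[OF tendsto_norm[OF s(2)[OF w]]])
    then have "\<forall>\<^sub>F i in sequentially. s i w = t i w"
      by eventually_elim (simp add: t_def)
    then show ?thesis using s(2)[OF w] by (rule Lim_transform_eventually[rotated])
  qed
  have t_int: "step_integrable M (t i)" for i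
  proof (rule simple_bochner_integrableI_bounded[OF t_simple])
    have "(\<integral>\<^sup>+w. norm (t i w) \<partial>M) \<le> (\<integral>\<^sup>+w. 2 * ennreal (norm (f w)) \<partial>M)"
      using t_le by (intro nn_integral_mono) (metis ennreal_leI ennreal_mult'' ennreal_numeral norm_ge_zero zero_le_numeral)
    also have "\<dots> < \<infinity>" using fin by (simp add: nn_integral_cmult ennreal_mult_less_top)
    finally show "(\<integral>\<^sup>+w. norm (t i w) \<partial>M) < \<infinity>" .
  qed
  have lim: "(\<lambda>i. \<integral>\<^sup>+w. norm (f w - t i w) \<partial>M) \<longlonglongrightarrow> (\<integral>\<^sup>+w. 0 \<partial>M)"
  proof (rule nn_integral_dominated_convergence)
    show "(\<lambda>w. ennreal (norm (f w - t i w))) \<in> borel_measurable M" for i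
      using borel_measurable_norm_strongly_measurable[OF strongly_measurable_diff[OF f
            strongly_measurable_simple[OF t_simple]]] by measurable
    show "(\<lambda>w. 3 * ennreal (norm (f w))) \<in> borel_measurable M" by measurable
    show "(\<integral>\<^sup>+w. 3 * ennreal (norm (f w)) \<partial>M) < \<infinity>"
      using fin by (simp add: nn_integral_cmult ennreal_mult_less_top)
    show "AE w in M. ennreal (norm (f w - t i w)) \<le> 3 * ennreal (norm (f w))" for i
    proof (rule AE_I2)
      fix w
      have "norm (f w - t i w) \<le> 3 * norm (f w)"
        using t_le[of i w] norm_triangle_ineq4[of "f w" "t i w"] by linarith
      then show "ennreal (norm (f w - t i w)) \<le> 3 * ennreal (norm (f w))"
        by (metis ennreal_leI ennreal_mult'' ennreal_numeral norm_ge_zero zero_le_numeral)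
    qed
    show "AE w in M. (\<lambda>i. ennreal (norm (f w - t i w))) \<longlonglongrightarrow> 0"
    proof (rule AE_I2)
      fix w assume "w \<in> space M"
      from tendsto_norm[OF tendsto_diff[OF tendsto_const[of "f w"] t_lim[OF this]]]
      show "(\<lambda>i. ennreal (norm (f w - t i w))) \<longlonglongrightarrow> 0"
        using tendsto_ennrealI by fastforce
    qed
  qed auto
  let ?S = "\<lambda>i. \<integral>\<^sup>+w. norm (f w - t i w) \<partial>M"
  have lim: "?S \<longlonglongrightarrow> 0" using lim by simp
  have "Cauchy (\<lambda>i. step_integral M (t i))"
  proof (rule metric_CauchyI)
    fix e :: real assume e: "0 < e"
    then have "\<forall>\<^sub>F i in sequentially. ?S i < ennreal (e/2)"
      by (intro order_tendstoD(2)[OF lim]) simp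
    then obtain N where N: "\<And>i. N \<le> i \<Longrightarrow> ?S i < ennreal (e/2)"
      by (auto simp: eventually_sequentially)
    show "\<exists>N. \<forall>m\<ge>N. \<forall>n\<ge>N. dist (step_integral M (t m)) (step_integral M (t n)) < e"
    proof (intro exI allI impI)
      fix m n assume mn: "N \<le> m" "N \<le> n"
      have "ennreal (norm (step_integral M (t m) - step_integral M (t n))) \<le> ?S m + ?S n"
        using step_integral_dist_le[OF f f t_int t_int, of m n] by simp
      also have "\<dots> < ennreal (e/2) + ennreal (e/2)" by (intro add_strict_mono N mn)
      also have "\<dots> = ennreal e" using e by (simp flip: ennreal_plus)
      finally show "dist (step_integral M (t m)) (step_integral M (t n)) < e"
        using e by (simp add: dist_norm ennreal_less_iff)
    qed
  qed
  then obtain I where "(\<lambda>i. step_integral M (t i)) \<longlonglongrightarrow> I"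
    using Cauchy_convergent convergent_def by blast
  then show ?thesis
    unfolding strong_integrable_def using has_strong_integralI[OF f t_int lim] by blast
qed

text \<open>
  Positivity cannot be checked on the approximating step functions, whose values need not be
  positive. It follows from its description by the norm: \<open>norm (norm (f w) - f w) \<le> norm (f w)\<close>
  integrates to \<open>norm (t - I) \<le> t\<close> with \<open>t\<close> the integral of \<open>norm (f w)\<close>.
\<close>

lemma has_strong_integral_positive:
  fixes f :: "'w \<Rightarrow> 'a::unital_cstar_algebra"
  assumes f: "has_strong_integral M f I" and pos: "\<And>w. w \<in> space M \<Longrightarrow> cstar_positive (f w)"
  shows "cstar_positive I"
proof -
  define t where "t = (\<integral>w. norm (f w) \<partial>M)"
  have sm: "strongly_measurable M f" using f by (rule has_strong_integralE)
  have int: "integrable M (\<lambda>w. norm (f w))"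
    using has_strong_integral_finite_norm[OF f]
    by (intro integrableI_bounded borel_measurable_norm_strongly_measurable[OF sm]) simp
  then have "has_strong_integral M (\<lambda>w. norm (f w)) t"
    unfolding has_strong_integral_iff_has_bochner_integral t_def by (rule has_bochner_integral_integrable)
  then have "has_strong_integral M (\<lambda>w. norm (f w) *\<^sub>R (1::'a)) (t *\<^sub>R 1)"
    by (rule has_strong_integral_bounded_linear[OF bounded_linear_scaleR_left])
  then have "ennreal (norm (t *\<^sub>R 1 - I)) \<le> (\<integral>\<^sup>+w. norm (norm (f w) *\<^sub>R 1 - f w) \<partial>M)"
    by (rule has_strong_integral_dist_le[OF _ f])
  also have "\<dots> \<le> (\<integral>\<^sup>+w. norm (f w) \<partial>M)"
    by (intro nn_integral_mono ennreal_leI cstar_positive_norm_le pos) auto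
  also have "\<dots> = ennreal t" unfolding t_def by (rule nn_integral_eq_integral[OF int]) simp
  finally have "norm (t *\<^sub>R 1 - I) \<le> t" by (simp add: t_def)
  moreover have "star I = I"
    using has_strong_integral_cong[OF has_strong_integral_bounded_linear[OF bounded_linear_star f]]
      has_strong_integral_unique[OF _ f] cstar_positive_selfadjoint[OF pos] by blast
  ultimately show ?thesis by (rule cstar_positiveI_norm[rotated])
qed

section \<open>Hilbert C*-modules\<close>

context hilbert_cstar_module
begin

lemma ip_add_right: "ip x (y + z) = ip x y + ip x z"
  unfolding ip_star[of x "y + z"] ip_star[of x y] ip_star[of x z] by (simp add: ip_add_left star_add)

lemma ip_scaleR_left: "ip (r *\<^sub>R x) y = r *\<^sub>R ip x y"
  using ip_smult_left[of "r *\<^sub>R 1" x y] by (simp add: smult_scaleR)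

lemma ip_scaleR_right: "ip x (r *\<^sub>R y) = r *\<^sub>R ip x y"
  unfolding ip_star[of x "r *\<^sub>R y"] ip_star[of x y] by (simp add: ip_scaleR_left star_scaleR)

lemma ip_smult_smult: "ip (smult a x) (smult a y) = a * ip x y * star a"
proof -
  have "ip x (smult a y) = ip x y * star a"
    unfolding ip_star[of x "smult a y"] ip_star[of x y] by (simp add: ip_smult_left star_mult)
  then show ?thesis by (simp add: ip_smult_left mult.assoc)
qed

lemma ip_diff_left: "ip (x - y) z = ip x z - ip y z"
  using ip_add_left[of "x - y" y z] by (simp add: algebra_simps)

lemma ip_diff_right: "ip x (y - z) = ip x y - ip x z"
  using ip_add_right[of x "y - z" z] by (simp add: algebra_simps)

lemma norm_ip_self: "norm (ip x x) = (norm x)\<^sup>2"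
  by (simp add: norm_ip)

text \<open>
  This and the next inequality come from the parallelogram law and stand in for Minkowski's
  inequality, at the price of a factor \<open>2\<close>.
\<close>

lemma ip_diff_le: "ip (u - v) (u - v) \<sqsubseteq> 2 *\<^sub>R (ip u u + ip v v)"
proof -
  have "2 *\<^sub>R (ip u u + ip v v) - ip (u - v) (u - v) = ip (u + v) (u + v)"
    by (simp add: ip_diff_left ip_diff_right ip_add_left ip_add_right scaleR_2)
  then show ?thesis by (simp add: cstar_le_def ip_positive)
qed

lemma ip_add_le: "ip (u + v) (u + v) \<sqsubseteq> 2 *\<^sub>R (ip u u + ip v v)"
proof -
  have "2 *\<^sub>R (ip u u + ip v v) - ip (u + v) (u + v) = ip (u - v) (u - v)"
    by (simp add: ip_diff_left ip_diff_right ip_add_left ip_add_right scaleR_2)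
  then show ?thesis by (simp add: cstar_le_def ip_positive)
qed

text \<open>
  A Cauchy-Schwarz inequality with a poor constant, from polarisation of unit vectors; it is what
  continuity of \<open>x \<mapsto> ip x x\<close> takes.
\<close>

lemma norm_ip_symmetrised_le: "norm (ip u v + ip v u) \<le> 4 * norm u * norm v"
proof -
  have unit: "norm (ip x y + ip y x) \<le> 4" if "norm x = 1" "norm y = 1" for x y
  proof -
    have "2 *\<^sub>R (ip x y + ip y x) = ip (x + y) (x + y) - ip (x - y) (x - y)"
      by (simp add: ip_diff_left ip_diff_right ip_add_left ip_add_right scaleR_2)
    then have "2 * norm (ip x y + ip y x) = norm (ip (x + y) (x + y) - ip (x - y) (x - y))"
      by (metis abs_numeral norm_scaleR)
    also have "\<dots> \<le> (norm (x + y))\<^sup>2 + (norm (x - y))\<^sup>2"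
      using norm_triangle_ineq4[of "ip (x + y) (x + y)" "ip (x - y) (x - y)"] by (simp add: norm_ip_self)
    also have "\<dots> \<le> 2\<^sup>2 + 2\<^sup>2"
      using norm_triangle_ineq[of x y] norm_triangle_ineq4[of x y] that by (intro add_mono power_mono) auto
    finally show ?thesis by simp
  qed
  have zero: "ip 0 x = 0" "ip x 0 = 0" for x
    using ip_scaleR_left[of 0 0 x] ip_scaleR_right[of x 0 0] by simp_all
  show ?thesis
  proof (cases "u = 0 \<or> v = 0")
    case True then show ?thesis using zero by auto
  next
    case False
    define x y where "x = (1 / norm u) *\<^sub>R u" and "y = (1 / norm v) *\<^sub>R v"
    have uv: "u = norm u *\<^sub>R x" "v = norm v *\<^sub>R y" using False by (simp_all add: x_def y_def)
    have "ip u v + ip v u = (norm u * norm v) *\<^sub>R (ip x y + ip y x)"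
      by (subst (1 2) uv(1), subst (1 2) uv(2))
        (simp add: ip_scaleR_left ip_scaleR_right scaleR_add_right mult.commute)
    then have "norm (ip u v + ip v u) = norm u * norm v * norm (ip x y + ip y x)" by simp
    also have "\<dots> \<le> norm u * norm v * 4"
      using False by (intro mult_left_mono unit) (simp_all add: x_def y_def)
    finally show ?thesis by (simp add: mult.commute mult.left_commute)
  qed
qed

lemma continuous_on_ip_self: "continuous_on UNIV (\<lambda>x. ip x x)"
proof -
  have "((\<lambda>x. ip x x) \<longlongrightarrow> ip y y) (at y)" for y
  proof (rule LIM_zero_cancel, rule Lim_null_comparison)
    show "\<forall>\<^sub>F x in at y. norm (ip x x - ip y y) \<le> 2 * norm (x - y) * norm (x + y)"
    proof (rule always_eventually, rule allI)
      fix x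
      have "2 *\<^sub>R (ip x x - ip y y) = ip (x - y) (x + y) + ip (x + y) (x - y)"
        by (simp add: ip_diff_left ip_diff_right ip_add_left ip_add_right scaleR_2)
      then have "2 * norm (ip x x - ip y y) = norm (ip (x - y) (x + y) + ip (x + y) (x - y))"
        by (metis abs_numeral norm_scaleR)
      then show "norm (ip x x - ip y y) \<le> 2 * norm (x - y) * norm (x + y)"
        using norm_ip_symmetrised_le[of "x - y" "x + y"] by simp
    qed
    have "((\<lambda>x. 2 * norm (x - y) * norm (x + y)) \<longlongrightarrow> 2 * norm (y - y) * norm (y + y)) (at y)"
      by (intro tendsto_intros)
    then show "((\<lambda>x. 2 * norm (x - y) * norm (x + y)) \<longlongrightarrow> 0) (at y)" by simp
  qed
  then show ?thesis by (simp add: continuous_on_def)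
qed

section \<open>Adjointable operators\<close>

lemma ip_left_ext:
  assumes "\<And>y. ip u y = ip v y" shows "u = v"
  using ip_definite[of "u - v"] assms[of "u - v"] by (simp add: ip_diff_left)

lemma ip_right_ext:
  assumes "\<And>y. ip y u = ip y v" shows "u = v"
  using ip_definite[of "u - v"] assms[of "u - v"] by (simp add: ip_diff_right)

lemma is_adjoint_adj:
  assumes "adjointable ip T" shows "is_adjoint ip T (adj ip T)"
proof -
  obtain S where S: "is_adjoint ip T S" using assms unfolding adjointable_def by blast
  have "adj ip T = S"
    unfolding adj_def
  proof (rule the_equality, rule S, rule ext)
    fix S' y assume "is_adjoint ip T S'"
    then show "S' y = S y" using S unfolding is_adjoint_def by (intro ip_right_ext) metis
  qed
  then show ?thesis using S by simp
qed

lemma is_adjoint_sym: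
  assumes "is_adjoint ip T S" shows "is_adjoint ip S T"
  unfolding is_adjoint_def
proof (intro allI)
  fix x y
  have "ip (S x) y = star (ip y (S x))" by (rule ip_star)
  also have "ip y (S x) = ip (T y) x" using assms by (simp add: is_adjoint_def)
  also have "star \<dots> = ip x (T y)" by (rule ip_star[symmetric])
  finally show "ip (S x) y = ip x (T y)" .
qed

lemma is_adjoint_smult:
  assumes "is_adjoint ip T S" shows "T (smult a x) = smult a (T x)"
  using assms by (intro ip_left_ext) (simp add: is_adjoint_def ip_smult_left)

lemma adjointable_smult: "adjointable ip T \<Longrightarrow> T (smult a x) = smult a (T x)"
  unfolding adjointable_def using is_adjoint_smult by blast

lemma adj_smult: "adjointable ip T \<Longrightarrow> adj ip T (smult a x) = smult a (adj ip T x)"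
  using is_adjoint_smult[OF is_adjoint_sym[OF is_adjoint_adj]] .

section \<open>Square integrals and K-operator frames\<close>

lemma has_strong_integral_square_integral:
  "square_integrable ip M T x \<Longrightarrow> has_strong_integral M (\<lambda>w. ip (T w x) (T w x)) (square_integral ip M T x)"
  unfolding square_integrable_def square_integral_def by (rule has_strong_integral_strong_integral)

lemma square_integral_positive:
  "square_integrable ip M T x \<Longrightarrow> cstar_positive (square_integral ip M T x)"
  by (rule has_strong_integral_positive[OF has_strong_integral_square_integral ip_positive])

lemma square_integral_smult:
  assumes T: "\<And>w. w \<in> space M \<Longrightarrow> adjointable ip (T w)" and x: "square_integrable ip M T x"
  shows "square_integral ip M T (smult a x) = a * square_integral ip M T x * star a"
  unfolding square_integral_def[of ip M T "smult a x"]
proof (rule strong_integral_eqI, rule has_strong_integral_cong)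
  have "bounded_linear (\<lambda>z. a * z * star a)"
    by (intro bounded_linear_mult_const bounded_linear_const_mult bounded_linear_ident)
  from has_strong_integral_bounded_linear[OF this has_strong_integral_square_integral[OF x]]
  show "has_strong_integral M (\<lambda>w. a * ip (T w x) (T w x) * star a) (a * square_integral ip M T x * star a)" .
  show "a * ip (T w x) (T w x) * star a = ip (T w (smult a x)) (T w (smult a x))" if "w \<in> space M" for w
    using adjointable_smult[OF T[OF that]] by (simp add: ip_smult_smult)
qed

lemma norm_square_integral_le:
  assumes U: "square_integrable ip M U x" and V: "square_integrable ip M V x" and W: "square_integrable ip M W x"
    and le: "\<And>w. ip (U w x) (U w x) \<sqsubseteq> 2 *\<^sub>R (ip (V w x) (V w x) + ip (W w x) (W w x))"
  shows "norm (square_integral ip M U x) \<le> 2 * (norm (square_integral ip M V x) + norm (square_integral ip M W x))"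
proof -
  let ?q = "\<lambda>T. square_integral ip M T x"
  have "has_strong_integral M
      (\<lambda>w. 2 *\<^sub>R (ip (V w x) (V w x) + ip (W w x) (W w x)) - ip (U w x) (U w x)) (2 *\<^sub>R (?q V + ?q W) - ?q U)"
    by (intro has_strong_integral_diff has_strong_integral_scaleR has_strong_integral_add
        has_strong_integral_square_integral U V W)
  then have "cstar_positive (2 *\<^sub>R (?q V + ?q W) - ?q U)"
    by (rule has_strong_integral_positive) (use le in \<open>simp add: cstar_le_def\<close>)
  then have "norm (?q U) \<le> norm (2 *\<^sub>R (?q V + ?q W))"
    by (intro cstar_positive_norm_mono square_integral_positive U) (simp add: cstar_le_def)
  also have "\<dots> \<le> 2 * (norm (?q V) + norm (?q W))"
    using norm_triangle_ineq[of "?q V" "?q W"] by simp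
  finally show ?thesis .
qed

lemma square_integrable_diff:
  assumes T: "strongly_measurable M (\<lambda>w. T w x)" "square_integrable ip M T x"
    and R: "strongly_measurable M (\<lambda>w. R w x)" "square_integrable ip M R x"
  shows "square_integrable ip M (\<lambda>w y. T w y - R w y) x"
  unfolding square_integrable_def
proof (rule strong_integrableI_bounded)
  show "strongly_measurable M (\<lambda>w. ip (T w x - R w x) (T w x - R w x))"
    by (rule strongly_measurable_compose[OF strongly_measurable_diff[OF T(1) R(1)] continuous_on_ip_self])
  have int: "has_strong_integral M (\<lambda>w. 2 *\<^sub>R ip (T w x) (T w x)) (2 *\<^sub>R square_integral ip M T x)"
    "has_strong_integral M (\<lambda>w. 2 *\<^sub>R ip (R w x) (R w x)) (2 *\<^sub>R square_integral ip M R x)"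
    by (intro has_strong_integral_scaleR has_strong_integral_square_integral T R)+
  have "(\<integral>\<^sup>+w. norm (ip (T w x - R w x) (T w x - R w x)) \<partial>M)
      \<le> (\<integral>\<^sup>+w. norm (2 *\<^sub>R ip (T w x) (T w x)) \<partial>M) + (\<integral>\<^sup>+w. norm (2 *\<^sub>R ip (R w x) (R w x)) \<partial>M)"
  proof (rule nn_integral_norm_triangle)
    show "strongly_measurable M (\<lambda>w. 2 *\<^sub>R ip (T w x) (T w x))" "strongly_measurable M (\<lambda>w. 2 *\<^sub>R ip (R w x) (R w x))"
      using int by (metis has_strong_integralE)+
    show "norm (ip (T w x - R w x) (T w x - R w x)) \<le> norm (2 *\<^sub>R ip (T w x) (T w x)) + norm (2 *\<^sub>R ip (R w x) (R w x))" for w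
      using cstar_positive_norm_mono[OF ip_positive ip_diff_le[of "T w x" "R w x"]]
        norm_triangle_ineq[of "2 *\<^sub>R ip (T w x) (T w x)" "2 *\<^sub>R ip (R w x) (R w x)"]
      by (simp only: scaleR_add_right)
  qed
  also have "\<dots> < \<infinity>" using int[THEN has_strong_integral_finite_norm] by simp
  finally show "(\<integral>\<^sup>+w. norm (ip (T w x - R w x) (T w x - R w x)) \<partial>M) < \<infinity>" .
qed

text \<open>
  The frame inequalities may be checked in norm, with the same bounds. Both sides of each are
  quadratic forms, on which replacing \<open>x\<close> by \<open>smult h x\<close> with \<open>h\<close> self-adjoint acts as conjugation by \<open>h\<close>, so
  that norm inequalities for all vectors are stable under conjugation and imply order
  inequalities.
\<close>

lemma K_operator_frame_bounds_iff_norm: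
  assumes K: "adjointable ip K"
  shows "K_operator_frame_bounds ip M K T A B \<longleftrightarrow>
    operator_family ip M T \<and> 0 < A \<and> 0 < B \<and>
    (\<forall>x. square_integrable ip M T x \<and>
         A * (norm (adj ip K x))\<^sup>2 \<le> norm (square_integral ip M T x) \<and>
         norm (square_integral ip M T x) \<le> B * (norm x)\<^sup>2)" (is "?L \<longleftrightarrow> ?R")
proof
  assume L: ?L
  then have A: "0 < A" and B: "0 < B" and int: "\<And>x. square_integrable ip M T x"
    and le: "\<And>x. A *\<^sub>R ip (adj ip K x) (adj ip K x) \<sqsubseteq> square_integral ip M T x"
      "\<And>x. square_integral ip M T x \<sqsubseteq> B *\<^sub>R ip x x" and fam: "operator_family ip M T"
    unfolding K_operator_frame_bounds_def by blast+
  have "A * (norm (adj ip K x))\<^sup>2 \<le> norm (square_integral ip M T x)" for x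
    using cstar_positive_norm_mono[OF cstar_positive_scaleR[OF ip_positive] le(1), of x] A
    by (simp add: norm_ip_self)
  moreover have "norm (square_integral ip M T x) \<le> B * (norm x)\<^sup>2" for x
    using cstar_positive_norm_mono[OF square_integral_positive[OF int] le(2), of x] B
    by (simp add: norm_ip_self)
  ultimately show ?R using A B int fam by blast
next
  assume R: ?R
  then have A: "0 < A" and B: "0 < B" and int: "\<And>x. square_integrable ip M T x"
    and le: "\<And>x. A * (norm (adj ip K x))\<^sup>2 \<le> norm (square_integral ip M T x)"
      "\<And>x. norm (square_integral ip M T x) \<le> B * (norm x)\<^sup>2" and fam: "operator_family ip M T"
    by blast+
  let ?q = "square_integral ip M T"
  have conj_q: "h * ?q x * h = ?q (smult h x)" if "star h = h" for h x
    using square_integral_smult[OF _ int, of h x] fam that by (simp add: operator_family_def)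
  have "A *\<^sub>R ip (adj ip K x) (adj ip K x) \<sqsubseteq> 1 *\<^sub>R ?q x" for x
  proof (rule cstar_le_scaleR_if_norm_conj_le)
    show "cstar_positive (?q x)" by (rule square_integral_positive[OF int])
    show "star (A *\<^sub>R ip (adj ip K x) (adj ip K x)) = A *\<^sub>R ip (adj ip K x) (adj ip K x)"
      using ip_star[of "adj ip K x" "adj ip K x"] by (simp add: star_scaleR)
    fix h :: 'a assume h: "star h = h"
    have "h * (A *\<^sub>R ip (adj ip K x) (adj ip K x)) * h = A *\<^sub>R ip (adj ip K (smult h x)) (adj ip K (smult h x))"
      using h by (simp add: adj_smult[OF K] ip_smult_smult)
    then show "norm (h * (A *\<^sub>R ip (adj ip K x) (adj ip K x)) * h) \<le> 1 * norm (h * ?q x * h)"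
      using le(1)[of "smult h x"] A by (simp add: conj_q[OF h] norm_ip_self)
  qed simp
  moreover have "?q x \<sqsubseteq> B *\<^sub>R ip x x" for x
  proof (rule cstar_le_scaleR_if_norm_conj_le)
    show "star (?q x) = ?q x"
      by (rule cstar_positive_selfadjoint[OF square_integral_positive[OF int]])
    fix h :: 'a assume h: "star h = h"
    have "h * ip x x * h = ip (smult h x) (smult h x)"
      using h by (simp add: ip_smult_smult)
    then show "norm (h * ?q x * h) \<le> B * norm (h * ip x x * h)"
      using le(2)[of "smult h x"] by (simp add: conj_q[OF h] norm_ip_self)
  qed (use B in \<open>auto intro: ip_positive\<close>)
  ultimately show ?L unfolding K_operator_frame_bounds_def using A B int fam by auto
qed

lemma coisometry_adj_norm:
  assumes "adjointable ip K" "\<And>x. K (adj ip K x) = x"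
  shows "norm (adj ip K x) = norm x"
proof -
  have "ip (adj ip K x) (adj ip K x) = ip (K (adj ip K x)) x"
    using is_adjoint_adj[OF assms(1)] by (simp add: is_adjoint_def)
  then show ?thesis by (simp add: norm_ip assms(2))
qed

end

theorem theorem5p4:
  fixes smult :: "'a::unital_cstar_algebra \<Rightarrow> 'h::banach \<Rightarrow> 'h"
    and ip :: "'h \<Rightarrow> 'h \<Rightarrow> 'a"
    and \<mu> :: "'w measure"
    and K :: "'h \<Rightarrow> 'h"
    and T R :: "'w \<Rightarrow> 'h \<Rightarrow> 'h"
    and A B :: real
  assumes "hilbert_cstar_module smult ip"
    and "adjointable ip K"
    and "K_operator_frame_bounds ip \<mu> K T A B"
    and "operator_family ip \<mu> R"
  shows
    "((\<exists>M>0. \<forall>x.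
         square_integrable ip \<mu> (\<lambda>w y. T w y - R w y) x \<and>
         square_integrable ip \<mu> T x \<and> square_integrable ip \<mu> R x \<and>
         norm (square_integral ip \<mu> (\<lambda>w y. T w y - R w y) x)
           \<le> M * min (norm (square_integral ip \<mu> T x)) (norm (square_integral ip \<mu> R x)))
       \<longrightarrow> K_operator_frame ip \<mu> K R)
     \<and> (surj K \<and> (\<forall>x. norm x \<le> norm (adj ip K x)) \<and> K_operator_frame ip \<mu> K R
       \<longrightarrow> (\<exists>M>0. \<forall>x.
         square_integrable ip \<mu> (\<lambda>w y. T w y - R w y) x \<and>
         square_integrable ip \<mu> T x \<and> square_integrable ip \<mu> R x \<and>
         norm (square_integral ip \<mu> (\<lambda>w y. T w y - R w y) x)
           \<le> M * min (norm (square_integral ip \<mu> T x)) (norm (square_integral ip \<mu> R x))))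
     \<and> ((\<forall>x. K (adj ip K x) = x) \<longrightarrow> surj K \<and> (\<forall>x. norm x \<le> norm (adj ip K x)))"
proof (intro conjI impI)
  interpret hilbert_cstar_module smult ip by fact
  define D where "D = (\<lambda>w y. T w y - R w y)"
  let ?q = "square_integral ip \<mu>"
  note K = assms(2) and R_family = assms(4)
  note frame_iff = K_operator_frame_bounds_iff_norm[OF K]
  from assms(3) have A: "0 < A" and B: "0 < B" and T_int: "\<And>x. square_integrable ip \<mu> T x"
    and T_family: "operator_family ip \<mu> T"
    and T_lower: "\<And>x. A * (norm (adj ip K x))\<^sup>2 \<le> norm (?q T x)"
    and T_upper: "\<And>x. norm (?q T x) \<le> B * (norm x)\<^sup>2"
    unfolding frame_iff by blast+
  {
    assume "\<exists>M>0. \<forall>x.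
         square_integrable ip \<mu> (\<lambda>w y. T w y - R w y) x \<and>
         square_integrable ip \<mu> T x \<and> square_integrable ip \<mu> R x \<and>
         norm (square_integral ip \<mu> (\<lambda>w y. T w y - R w y) x)
           \<le> M * min (norm (square_integral ip \<mu> T x)) (norm (square_integral ip \<mu> R x))"
    then obtain M where M: "0 < M" and D_int: "\<And>x. square_integrable ip \<mu> D x"
      and R_int: "\<And>x. square_integrable ip \<mu> R x"
      and D_le: "\<And>x. norm (?q D x) \<le> M * min (norm (?q T x)) (norm (?q R x))"
      unfolding D_def by blast
    have D_le_T: "norm (?q D x) \<le> M * norm (?q T x)" and D_le_R: "norm (?q D x) \<le> M * norm (?q R x)" for x
      using D_le[of x] mult_left_mono[OF min.cobounded1, of M "norm (?q T x)" "norm (?q R x)"]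
        mult_left_mono[OF min.cobounded2, of M "norm (?q T x)" "norm (?q R x)"] M by linarith+
    \<comment> \<open>\<open>R = T - D\<close> and \<open>T = D + R\<close> make the two square integrals comparable with constant \<open>c\<close>.\<close>
    define c where "c = 2 * (1 + M)"
    have c: "0 < c" using M by (simp add: c_def)
    have R_le_T: "norm (?q R x) \<le> c * norm (?q T x)" for x
    proof -
      have "norm (?q R x) \<le> 2 * (norm (?q T x) + norm (?q D x))"
        using ip_diff_le[of "T w x" "D w x" for w]
        by (intro norm_square_integral_le R_int T_int D_int) (simp add: D_def)
      then show ?thesis using D_le_T[of x] by (simp add: c_def algebra_simps)
    qed
    have T_le_R: "norm (?q T x) \<le> c * norm (?q R x)" for x
    proof -
      have "norm (?q T x) \<le> 2 * (norm (?q D x) + norm (?q R x))"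
        using ip_add_le[of "D w x" "R w x" for w]
        by (intro norm_square_integral_le R_int T_int D_int) (simp add: D_def)
      then show ?thesis using D_le_R[of x] by (simp add: c_def algebra_simps)
    qed
    have "K_operator_frame_bounds ip \<mu> K R (A / c) (c * B)"
      unfolding frame_iff
    proof (intro conjI allI R_family R_int)
      show "0 < A / c" "0 < c * B" using A B c by simp_all
      show "A / c * (norm (adj ip K x))\<^sup>2 \<le> norm (?q R x)" for x
        using order_trans[OF T_lower T_le_R, of x] c by (simp add: field_simps)
      show "norm (?q R x) \<le> c * B * (norm x)\<^sup>2" for x
        using order_trans[OF R_le_T mult_left_mono[OF T_upper less_imp_le[OF c]], of x]
        by (simp add: mult.assoc)
    qed
    then show "K_operator_frame ip \<mu> K R" unfolding K_operator_frame_def by blast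
  }
  {
    assume asm: "surj K \<and> (\<forall>x. norm x \<le> norm (adj ip K x)) \<and> K_operator_frame ip \<mu> K R"
    then obtain A' B' where A': "0 < A'" and B': "0 < B'" and R_int: "\<And>x. square_integrable ip \<mu> R x"
      and R_lower: "\<And>x. A' * (norm (adj ip K x))\<^sup>2 \<le> norm (?q R x)"
      and R_upper: "\<And>x. norm (?q R x) \<le> B' * (norm x)\<^sup>2"
      unfolding K_operator_frame_def frame_iff by blast
    have D_int: "square_integrable ip \<mu> D x" for x
      unfolding D_def using T_family R_family T_int R_int
      by (intro square_integrable_diff) (auto simp: operator_family_def)
    define a where "a = min A A'"
    have a: "0 < a" using A A' by (simp add: a_def)
    define M where "M = 2 * (B + B') / a"
    have "0 < M" using a B B' by (simp add: M_def)
    moreover have "norm (?q D x) \<le> M * min (norm (?q T x)) (norm (?q R x))" for x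
    proof -
      have x: "(norm x)\<^sup>2 \<le> (norm (adj ip K x))\<^sup>2" using asm by (intro power_mono) auto
      have "a * (norm x)\<^sup>2 \<le> A * (norm (adj ip K x))\<^sup>2" "a * (norm x)\<^sup>2 \<le> A' * (norm (adj ip K x))\<^sup>2"
        using x a A A' by (auto intro!: mult_mono simp: a_def)
      then have lower: "a * (norm x)\<^sup>2 \<le> min (norm (?q T x)) (norm (?q R x))"
        using T_lower[of x] R_lower[of x] by simp
      have "norm (?q D x) \<le> 2 * (norm (?q T x) + norm (?q R x))"
        using ip_diff_le[of "T w x" "R w x" for w]
        by (intro norm_square_integral_le R_int T_int D_int) (simp add: D_def)
      also have "\<dots> \<le> 2 * (B + B') * (norm x)\<^sup>2"
        using T_upper[of x] R_upper[of x] by (simp add: algebra_simps)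
      also have "\<dots> = M * (a * (norm x)\<^sup>2)" using a by (simp add: M_def)
      also have "\<dots> \<le> M * min (norm (?q T x)) (norm (?q R x))"
        using \<open>0 < M\<close> by (intro mult_left_mono lower) auto
      finally show ?thesis .
    qed
    ultimately show "\<exists>M>0. \<forall>x.
         square_integrable ip \<mu> (\<lambda>w y. T w y - R w y) x \<and>
         square_integrable ip \<mu> T x \<and> square_integrable ip \<mu> R x \<and>
         norm (square_integral ip \<mu> (\<lambda>w y. T w y - R w y) x)
           \<le> M * min (norm (square_integral ip \<mu> T x)) (norm (square_integral ip \<mu> R x))"
      using D_int T_int R_int unfolding D_def by blast
  }
  {
    assume coiso: "\<forall>x. K (adj ip K x) = x"
    then show "surj K" by (metis surjI)
    show "\<forall>x. norm x \<le> norm (adj ip K x)"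
      using coisometry_adj_norm[OF K] coiso by simp
  }
qed

end
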